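(* Let $l\ge2\max(\underline N_{\mathfrak C},\underline N_\Gamma)$ and let $$M^{(1,2)}:=\begin{bmatrix}0_{2\underline N_{\mathfrak C}\times2\underline N_\Gamma}&\overline{\mathfrak C^{(1,2)}_{2,l}}\\-\overline{\Gamma^{(1,2)}_{2,l}}&0_{2\underline N_\Gamma\times2\underline N_{\mathfrak C}}\end{bmatrix},\qquad M^{(2,1)}:=\begin{bmatrix}0_{2\underline N_{\mathfrak C}\times2\underline N_\Gamma}&\mathfrak C^{(2,1)}_{1,l}\\-\Gamma^{(2,1)}_{1,l}&0_{2\underline N_\Gamma\times2\underline N_{\mathfrak C}}\end{bmatrix}.$$ Under Geronimus–Uvarov transformations the mixed Christoffel–Darboux kernels satisfy, for $x_1,x_2\in\mathbb C^*$, the following connection formulas. (i) For $\bar x_1\notin\operatorname{supp}_1(u)\cup\operatorname{supp}_1(\tilde u^{(1,2)})$, $$L^{(1)}_\Gamma(\bar x_1)\tilde K^{(1,2),[l]}_{C_2}(\bar x_1,x_2)-L^{(1)}_\Gamma(x_2)K^{[l]}_{C_2}(\bar x_1,x_2)-\delta L^{(1)}_\Gamma(\bar x_1,x_2)=\Big[\tfrac{\tilde\phi^{(1,2)}_{1,l-2\underline N_{\mathfrak C}}(x_2)}{\tilde H^{(1,2)}_{l-2\underline N_{\mathfrak C}}},\dots,\tfrac{\tilde\phi^{(1,2)}_{1,l+2\underline N_\Gamma-1}(x_2)}{\tilde H^{(1,2)}_{l+2\underline N_\Gamma-1}}\Big]M^{(1,2)}\begin{bmatrix}\overline{C_{2,l-2\underline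 N_\Gamma}(x_1)}\\\vdots\\\overline{C_{2,l+2\underline N_{\mathfrak C}-1}(x_1)}\end{bmatrix}.$$ (ii) For $\bar x_1\notin\operatorname{supp}_1(u)\cup\operatorname{supp}_1(\tilde u^{(2,1)})$, $$L^{(1)}_{\mathfrak C}(x_2)\tilde K^{(2,1),[l]}_{C_2}(\bar x_1,x_2)-\Big\langle\frac{L^{(1)}_{\mathfrak C}(z_1)}{\bar x_1-z_1},\overline{K^{[l]}(\bar z_2,x_2)}\Big\rangle_u=\Big[\tfrac{\overline{\tilde C^{(2,1)}_{2,l-2\underline N_{\mathfrak C}}(x_1)}}{\tilde H^{(2,1)}_{l-2\underline N_{\mathfrak C}}},\dots,\tfrac{\overline{\tilde C^{(2,1)}_{2,l+2\underline N_\Gamma-1}(x_1)}}{\tilde H^{(2,1)}_{l+2\underline N_\Gamma-1}}\Big]M^{(2,1)}\begin{bmatrix}\phi_{1,l-2\underline N_\Gamma}(x_2)\\\vdots\\\phi_{1,l+2\underline N_{\mathfrak C}-1}(x_2)\end{bmatrix}.$$ (iii) For $\bar x_2\notin\operatorname{supp}_2(u)\cup\operatorname{supp}_2(\tilde u^{(1,2)})$, $$\overline{L^{(2)}_{\mathfrak C}(x_1)}\tilde K^{(1,2),[l]}_{C_1}(\bar x_1,x_2)-\Big\langle K^{[l]}(\bar x_1,z_1),\frac{L^{(2)}_{\mathfrak C}(z_2)}{\bar x_2-z_2}\Big\rangle_u=\Big[\tfrac{\tilde C^{(1,2)}_{1,l-2\underline N_{\mathfrak C}}(x_2)}{\tilde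 H^{(1,2)}_{l-2\underline N_{\mathfrak C}}},\dots,\tfrac{\tilde C^{(1,2)}_{1,l+2\underline N_\Gamma-1}(x_2)}{\tilde H^{(1,2)}_{l+2\underline N_\Gamma-1}}\Big]M^{(1,2)}\begin{bmatrix}\overline{\phi_{2,l-2\underline N_\Gamma}(x_1)}\\\vdots\\\overline{\phi_{2,l+2\underline N_{\mathfrak C}-1}(x_1)}\end{bmatrix}.$$ (iv) For $\bar x_2\notin\operatorname{supp}_2(u)\cup\operatorname{supp}_2(\tilde u^{(2,1)})$, $$\overline{L^{(2)}_\Gamma}(x_2)\tilde K^{(2,1),[l]}_{C_1}(\bar x_1,x_2)-\overline{L^{(2)}_\Gamma}(\bar x_1)K^{[l]}_{C_1}(\bar x_1,x_2)-\delta\overline{L^{(2)}_\Gamma}(\bar x_1,x_2)=\Big[\tfrac{\overline{\tilde\phi^{(2,1)}_{2,l-2\underline N_{\mathfrak C}}(x_1)}}{\tilde H^{(2,1)}_{l-2\underline N_{\mathfrak C}}},\dots,\tfrac{\overline{\tilde\phi^{(2,1)}_{2,l+2\underline N_\Gamma-1}(x_1)}}{\tilde H^{(2,1)}_{l+2\underline N_\Gamma-1}}\Big]M^{(2,1)}\begin{bmatrix}C_{1,l-2\underline N_\Gamma}(x_2)\\\vdots\\C_{1,l+2\underline N_{\mathfrak C}-1}(x_2)\end{bmatrix}.$$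
   Context: Conventions: $\mathbb C^*=\mathbb C\setminus\{0\}$; $\dagger$ is conjugate transpose; for a Laurent polynomial $\overline L(z):=\overline{L(\bar z)}$; $\sigma(L)$ is the zero set of $L$ in $\mathbb C^*$; $f^{(l)}=\partial^lf/\partial z^l$; $\delta L(z_1,z_2):=\frac{L(z_1)-L(z_2)}{z_1-z_2}$ (a Laurent polynomial in two variables). Functionals: $\mathcal F$ is a space of fundamental (test) functions on $\mathbb C^*$ strictly containing $\mathbb C[z,z^{-1}]$, whose continuous linear functionals have a well-defined support (e.g. $\mathcal F=C^\infty(\mathbb C^* )$, functionals being compactly supported distributions). A functional may be evaluated on functions admissible only on a neighbourhood of its support. $u=u_{z_1,\bar z_2}$ is a bivariate linear functional with well-defined support; $\operatorname{supp}_1,\operatorname{supp}_2$ are the projections of the support to the $z_1$- and $z_2$-coordinates. Its sesquilinear form is $\langle f(z_1),g(z_2)\rangle_u=\langle u_{z_1,\bar z_2},f(z_1)\otimes\overline{g(z_2)}\rangle$. CMV basis: $\chi=[\chi^{(0)},\chi^{(1)},\dots]^\top$, $\chi^{(2k)}(z)=z^k$, $\chi^{(2k+1)}(z)=z^{-k-1}$. $\Upsilon$ is the semi-infinite $0/1$ matrix with nonzero entries $\Upsilon_{2k,2k+2}=1$ ($k\ge0$), $\Upsilon_{1,0}=1$, $\Upsilon_{2k+1,2k-1}=1$ ($k\ge1$); $\Upsilon\chi(z)=z\chi(z)$, $\Upsilon^{-1}=\Upsilon^\top$; for $L(z)=\sum_kL_kz^k$, $L(\Upsilon)=\sum_kL_k\Upsilon^k$.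 Gram matrix $G=(\langle\chi^{(k)},\chi^{(l)}\rangle_u)_{k,l\ge0}$, assumed quasidefinite (all leading principal minors nonzero), so $G=S_1^{-1}H(S_2^{-1})^\dagger$ with $S_1,S_2$ lower unitriangular and $H=\operatorname{diag}(H_0,H_1,\dots)$ nonsingular. $\phi_1=S_1\chi$, $\phi_2=S_2\chi$, with components $\phi_{1,k},\phi_{2,k}$. Geronimus–Uvarov perturbations: for $a\in\{1,2\}$, $L^{(a)}_\rho(z)=L^{(a)}_{\rho,N^+_\rho}z^{N^+_\rho}+\dots+L^{(a)}_{\rho,-N^-_\rho}z^{-N^-_\rho}$, $\rho\in\{\Gamma,\mathfrak C\}$, $N^\pm_\rho\in\{1,2,\dots\}$, with nonzero extreme coefficients, $\sigma(L^{(1)}_\Gamma)\cap\operatorname{supp}_1(u)=\varnothing$, $\sigma(L^{(2)}_\Gamma)\cap\operatorname{supp}_2(u)=\varnothing$; $\underline N_\rho:=\max(N^+_\rho,N^-_\rho)$. $L^{(a)}_\Gamma$ has distinct zeros $\zeta^{(a)}_i$ with multiplicities $m^{(a)}_i$, $1\le i\le d^{(a)}$; $\xi^{(a)}_{i,l}$ are arbitrary univariate linear functionals. The perturbed forms are $$\langle f,g\rangle_{\tilde u^{(1,2)}}=\Big\langle u,\tfrac{f(z_1)}{L^{(1)}_\Gamma(z_1)}\otimes\overline{L^{(2)}_{\mathfrak C}(z_2)g(z_2)}\Big\rangle+\sum_{i=1}^{d^{(1)}}\sum_{l=0}^{m^{(1)}_i-1}\tfrac1{l!}f^{(l)}(\zeta^{(1)}_i)\overline{\langle\xi^{(1)}_{i,l},L^{(2)}_{\mathfrak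 C}g\rangle},$$ $$\langle f,g\rangle_{\tilde u^{(2,1)}}=\Big\langle u,L^{(1)}_{\mathfrak C}(z_1)f(z_1)\otimes\overline{\tfrac{g(z_2)}{L^{(2)}_\Gamma(z_2)}}\Big\rangle+\sum_{i=1}^{d^{(2)}}\sum_{l=0}^{m^{(2)}_i-1}\tfrac1{l!}\langle\xi^{(2)}_{i,l},L^{(1)}_{\mathfrak C}f\rangle\overline{g^{(l)}(\zeta^{(2)}_i)}.$$ Their Gram matrices $\tilde G^{(1)}$ (of $\tilde u^{(1,2)}$) and $\tilde G^{(2)}$ (of $\tilde u^{(2,1)}$) in the CMV basis are assumed quasidefinite: $\tilde G^{(1)}=(\tilde S^{(1)}_1)^{-1}\tilde H^{(1,2)}(\tilde S^{(1)}_2)^{-\dagger}$, $\tilde G^{(2)}=(\tilde S^{(2)}_1)^{-1}\tilde H^{(2,1)}(\tilde S^{(2)}_2)^{-\dagger}$ (lower unitriangular $\tilde S$'s, diagonal nonsingular $\tilde H$'s with entries $\tilde H^{(1,2)}_k,\tilde H^{(2,1)}_k$); $\tilde\phi^{(1,2)}_j=\tilde S^{(1)}_j\chi$, $\tilde\phi^{(2,1)}_j=\tilde S^{(2)}_j\chi$, $j=1,2$. Second kind functions: $C_{1,k}(z)=\langle\phi_{1,k}(z_1),\frac1{\bar z-z_2}\rangle_u$ for $\bar z\notin\operatorname{supp}_2(u)$; $\overline{C_{2,k}(z)}=\langle\frac1{\bar z-z_1},\phi_{2,k}(z_2)\rangle_u$ for $\bar z\notin\operatorname{supp}_1(u)$.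 Kernels: $K^{[l]}(\bar z_1,z_2)=\sum_{k=0}^{l-1}\overline{\phi_{2,k}(z_1)}H_k^{-1}\phi_{1,k}(z_2)$, $K^{[l]}_{C_2}(\bar z_1,z_2)=\sum_{k=0}^{l-1}\overline{C_{2,k}(z_1)}H_k^{-1}\phi_{1,k}(z_2)$, $K^{[l]}_{C_1}(\bar z_1,z_2)=\sum_{k=0}^{l-1}\overline{\phi_{2,k}(z_1)}H_k^{-1}C_{1,k}(z_2)$. Objects with a tilde and superscript $(1,2)$, respectively $(2,1)$, are defined in the same way from $\tilde u^{(1,2)},\tilde\phi^{(1,2)}_{j,k},\tilde H^{(1,2)}_k$, respectively $\tilde u^{(2,1)},\tilde\phi^{(2,1)}_{j,k},\tilde H^{(2,1)}_k$. Connectors: $\Omega^{(1,2)}_2=\tilde S^{(1)}_2L^{(2)}_{\mathfrak C}(\Upsilon)S_2^{-1}$, $\Omega^{(2,1)}_1=\tilde S^{(2)}_1L^{(1)}_{\mathfrak C}(\Upsilon)S_1^{-1}$; they are banded, with entries $(p,q)$ vanishing unless $-2\underline N_\Gamma\le q-p\le2\underline N_{\mathfrak C}$. $\Gamma^{(1,2)}_{2,l}$ is the (upper triangular) $2\underline N_\Gamma\times2\underline N_\Gamma$ matrix with entries $(\Omega^{(1,2)}_2)_{l+i,\,l-2\underline N_\Gamma+j}$, $0\le i,j\le2\underline N_\Gamma-1$; $\mathfrak C^{(1,2)}_{2,l}$ is the (lower triangular) $2\underline N_{\mathfrak C}\times2\underline N_{\mathfrak C}$ matrix with entries $(\Omega^{(1,2)}_2)_{l-2\underline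 N_{\mathfrak C}+i,\,l+j}$, $0\le i,j\le2\underline N_{\mathfrak C}-1$. $\Gamma^{(2,1)}_{1,l},\mathfrak C^{(2,1)}_{1,l}$ are defined in the same way from $\Omega^{(2,1)}_1$. *)

theory Defs
  imports
    "HOL-Analysis.Analysis"
    "HOL-Library.Poly_Mapping"
    "Jordan_Normal_Form.Determinant"
begin

section \<open>Laurent polynomials\<close>

text \<open>The ring of Laurent polynomials is the convolution ring \<open>int \<Rightarrow>\<^sub>0 complex\<close>.
  All functions are total on \<open>complex\<close>; only their values on the punctured plane
  \<open>- {0}\<close> carry meaning.\<close>

type_synonym laurent = "int \<Rightarrow>\<^sub>0 complex"

definition leval :: "laurent \<Rightarrow> complex \<Rightarrow> complex" where
  "leval L z = (\<Sum>k\<in>Poly_Mapping.keys L. Poly_Mapping.lookup L k * z powi k)"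

text \<open>Coefficients range over the exponents \<open>- Nm, \<dots>, Np\<close> and the extreme ones do not vanish.\<close>

definition laurent_degrees :: "laurent \<Rightarrow> nat \<Rightarrow> nat \<Rightarrow> bool" where
  "laurent_degrees L Np Nm \<longleftrightarrow>
     1 \<le> Np \<and> 1 \<le> Nm \<and> Poly_Mapping.keys L \<subseteq> {- int Nm..int Np} \<and>
     Poly_Mapping.lookup L (int Np) \<noteq> 0 \<and> Poly_Mapping.lookup L (- int Nm) \<noteq> 0"

definition lzeros :: "laurent \<Rightarrow> complex set" where
  "lzeros L = {z. z \<noteq> 0 \<and> leval L z = 0}"

definition lmult :: "laurent \<Rightarrow> complex \<Rightarrow> nat" where
  "lmult L z = (LEAST m. (deriv ^^ m) (leval L) z \<noteq> 0)"

definition zeros_enum :: "laurent \<Rightarrow> nat \<Rightarrow> (nat \<Rightarrow> complex) \<Rightarrow> (nat \<Rightarrow> nat) \<Rightarrow> bool" where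
  "zeros_enum L d \<zeta> m \<longleftrightarrow>
     bij_betw \<zeta> {1..d} (lzeros L) \<and> (\<forall>i\<in>{1..d}. m i = lmult L (\<zeta> i))"

definition lbar :: "laurent \<Rightarrow> complex \<Rightarrow> complex" where
  "lbar L z = cnj (leval L (cnj z))"

text \<open>The difference quotient is a Laurent polynomial in two variables, so on the diagonal
  its value is the derivative. It is stated for the evaluated polynomial in order to apply
  to both \<open>leval L\<close> and \<open>lbar L\<close>.\<close>

definition diff_quot :: "(complex \<Rightarrow> complex) \<Rightarrow> complex \<Rightarrow> complex \<Rightarrow> complex" where
  "diff_quot f z1 z2 = (if z1 = z2 then deriv f z1 else (f z1 - f z2) / (z1 - z2))"


section \<open>Fundamental functions\<close>

text \<open>The derivative \<open>\<partial>/\<partial>z\<close> of a function that is only real differentiable: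
  \<open>(\<partial>\<^sub>x - \<i> \<partial>\<^sub>y)/2\<close>. It agrees with \<open>deriv\<close> on holomorphic functions.\<close>

definition dz :: "(complex \<Rightarrow> complex) \<Rightarrow> complex \<Rightarrow> complex" where
  "dz f z = (frechet_derivative f (at z) 1 - \<i> * frechet_derivative f (at z) \<i>) / 2"

definition agree_near :: "complex set \<Rightarrow> (complex \<Rightarrow> complex) \<Rightarrow> (complex \<Rightarrow> complex) \<Rightarrow> bool" where
  "agree_near S f g \<longleftrightarrow> (\<exists>W. open W \<and> S \<subseteq> W \<and> (\<forall>z\<in>W - {0}. f z = g z))"

text \<open>A space of fundamental functions on the punctured plane. A function is \<^emph>\<open>admissible on a
  neighbourhood of \<open>S\<close>\<close> if it agrees near \<open>S\<close> with a fundamental function. The last axiom says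
  that dividing by a Laurent polynomial without zeros on a relatively closed set \<open>S\<close> gives a
  function admissible on a neighbourhood of \<open>S\<close>. For the smooth functions on the punctured plane
  it holds by multiplication with a cut-off function.\<close>

locale fundamental_space =
  fixes F :: "(complex \<Rightarrow> complex) set"
  assumes add: "f \<in> F \<Longrightarrow> g \<in> F \<Longrightarrow> (\<lambda>z. f z + g z) \<in> F"
    and scale: "f \<in> F \<Longrightarrow> (\<lambda>z. c * f z) \<in> F"
    and laurent: "leval L \<in> F"
    and laurent_strict: "\<exists>f\<in>F. \<forall>L. \<exists>z. z \<noteq> 0 \<and> f z \<noteq> leval L z"
    and laurent_mult: "f \<in> F \<Longrightarrow> (\<lambda>z. leval L z * f z) \<in> F"
    and differentiable: "f \<in> F \<Longrightarrow> z \<noteq> 0 \<Longrightarrow> f differentiable (at z)"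
    and dz: "f \<in> F \<Longrightarrow> dz f \<in> F"
    and admissible_quotient:
      "closedin (top_of_set (- {0})) S \<Longrightarrow> lzeros L \<inter> S = {} \<Longrightarrow> f \<in> F \<Longrightarrow>
        \<exists>g\<in>F. agree_near S (\<lambda>z. f z / leval L z) g"

definition linear_functional ::
    "(complex \<Rightarrow> complex) set \<Rightarrow> ((complex \<Rightarrow> complex) \<Rightarrow> complex) \<Rightarrow> bool" where
  "linear_functional F \<xi> \<longleftrightarrow>
     (\<forall>f\<in>F. \<forall>g\<in>F. \<xi> (\<lambda>z. f z + g z) = \<xi> f + \<xi> g) \<and>
     (\<forall>f\<in>F. \<forall>c. \<xi> (\<lambda>z. c * f z) = c * \<xi> f)"


section \<open>Bivariate functionals\<close>

text \<open>A bivariate functional is represented by its values on the products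
  \<open>f(z\<^sub>1) cnj (g(z\<^sub>2))\<close>, that is, by its sesquilinear form.\<close>

type_synonym form = "(complex \<Rightarrow> complex) \<Rightarrow> (complex \<Rightarrow> complex) \<Rightarrow> complex"

definition sesquilinear :: "(complex \<Rightarrow> complex) set \<Rightarrow> form \<Rightarrow> bool" where
  "sesquilinear F u \<longleftrightarrow>
     (\<forall>g\<in>F. linear_functional F (\<lambda>f. u f g)) \<and>
     (\<forall>f\<in>F. linear_functional F (\<lambda>g. cnj (u f g)))"

definition supported_in :: "complex set \<Rightarrow> (complex \<Rightarrow> complex) \<Rightarrow> bool" where
  "supported_in U f \<longleftrightarrow> (\<exists>K. closed K \<and> K - {0} \<subseteq> U \<and> (\<forall>z. z \<noteq> 0 \<and> z \<notin> K \<longrightarrow> f z = 0))"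

text \<open>A point lies outside the support iff the functional vanishes on all products supported
  in some open box around it. For distributions this is the usual support, since the products
  supported in a box span a dense subspace of the test functions supported in it.\<close>

definition form_support :: "(complex \<Rightarrow> complex) set \<Rightarrow> form \<Rightarrow> (complex \<times> complex) set" where
  "form_support F u =
     {(z1, z2). z1 \<noteq> 0 \<and> z2 \<noteq> 0 \<and>
        \<not> (\<exists>U V. open U \<and> open V \<and> z1 \<in> U \<and> z2 \<in> V \<and>
             (\<forall>f\<in>F. \<forall>g\<in>F. supported_in U f \<and> supported_in V g \<longrightarrow> u f g = 0))}"

definition supp1 :: "(complex \<Rightarrow> complex) set \<Rightarrow> form \<Rightarrow> complex set" where
  "supp1 F u = fst ` form_support F u"

definition supp2 :: "(complex \<Rightarrow> complex) set \<Rightarrow> form \<Rightarrow> complex set" where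
  "supp2 F u = snd ` form_support F u"

text \<open>The support is well defined: the value on a product of fundamental functions depends only
  on the factors near the two projections of the support. The projections have to be relatively
  closed, which is automatic for compact supports.\<close>

definition bivariate_functional :: "(complex \<Rightarrow> complex) set \<Rightarrow> form \<Rightarrow> bool" where
  "bivariate_functional F u \<longleftrightarrow>
     sesquilinear F u \<and>
     closedin (top_of_set (- {0})) (supp1 F u) \<and>
     closedin (top_of_set (- {0})) (supp2 F u) \<and>
     (\<forall>f\<in>F. \<forall>g\<in>F. agree_near (supp1 F u) f (\<lambda>_. 0) \<or> agree_near (supp2 F u) g (\<lambda>_. 0)
        \<longrightarrow> u f g = 0)"

text \<open>Evaluation of the sesquilinear form on functions that are only admissible on neighbourhoods
  of the projections of the support. The choice is immaterial for a \<open>bivariate_functional\<close>, and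
  on \<open>F\<close> the result is \<open>u f g\<close>.\<close>

definition bracket :: "(complex \<Rightarrow> complex) set \<Rightarrow> form \<Rightarrow> form" where
  "bracket F u f g =
     u (SOME f'. f' \<in> F \<and> agree_near (supp1 F u) f f')
       (SOME g'. g' \<in> F \<and> agree_near (supp2 F u) g g')"


section \<open>Semi-infinite matrices and the CMV basis\<close>

type_synonym smat = "nat \<Rightarrow> nat \<Rightarrow> complex"

text \<open>All products used below have finitely many nonzero terms in each entry.\<close>

definition sm_mult :: "smat \<Rightarrow> smat \<Rightarrow> smat" where
  "sm_mult A B = (\<lambda>i j. Sum_any (\<lambda>k. A i k * B k j))"

definition sm_one :: smat where
  "sm_one = (\<lambda>i j. if i = j then 1 else 0)"

definition sm_diag :: "(nat \<Rightarrow> complex) \<Rightarrow> smat" where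
  "sm_diag H = (\<lambda>i j. if i = j then H i else 0)"

definition sm_transpose :: "smat \<Rightarrow> smat" where
  "sm_transpose A = (\<lambda>i j. A j i)"

definition sm_adjoint :: "smat \<Rightarrow> smat" where
  "sm_adjoint A = (\<lambda>i j. cnj (A j i))"

primrec sm_power :: "smat \<Rightarrow> nat \<Rightarrow> smat" where
  "sm_power A 0 = sm_one"
| "sm_power A (Suc n) = sm_mult A (sm_power A n)"

definition lower_unitriangular :: "smat \<Rightarrow> bool" where
  "lower_unitriangular S \<longleftrightarrow> (\<forall>i. S i i = 1) \<and> (\<forall>i j. i < j \<longrightarrow> S i j = 0)"

text \<open>The inverse of a lower unitriangular matrix among the lower unitriangular ones.\<close>

definition sm_inv :: "smat \<Rightarrow> smat" where
  "sm_inv S = (THE T. lower_unitriangular T \<and> sm_mult S T = sm_one \<and> sm_mult T S = sm_one)"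

definition quasidefinite :: "smat \<Rightarrow> bool" where
  "quasidefinite G \<longleftrightarrow> (\<forall>n. Determinant.det (Matrix.mat n n (\<lambda>(i, j). G i j)) \<noteq> 0)"

definition gauss_borel :: "smat \<Rightarrow> smat \<Rightarrow> (nat \<Rightarrow> complex) \<Rightarrow> smat \<Rightarrow> bool" where
  "gauss_borel G S1 H S2 \<longleftrightarrow>
     lower_unitriangular S1 \<and> lower_unitriangular S2 \<and> (\<forall>k. H k \<noteq> 0) \<and>
     G = sm_mult (sm_mult (sm_inv S1) (sm_diag H)) (sm_adjoint (sm_inv S2))"

definition cmv :: "nat \<Rightarrow> complex \<Rightarrow> complex" where
  "cmv k z = (if even k then z powi int (k div 2) else z powi (- int (k div 2) - 1))"

definition gram :: "(complex \<Rightarrow> complex) set \<Rightarrow> form \<Rightarrow> smat" where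
  "gram F u = (\<lambda>k l. bracket F u (cmv k) (cmv l))"

definition upsilon :: smat where
  "upsilon = (\<lambda>i j. if even i \<and> j = i + 2 \<or> i = 1 \<and> j = 0 \<or> odd i \<and> i = j + 2 then 1 else 0)"

text \<open>Negative powers use that the inverse of \<open>upsilon\<close> is its transpose.\<close>

definition upsilon_powi :: "int \<Rightarrow> smat" where
  "upsilon_powi k =
     (if 0 \<le> k then sm_power upsilon (nat k) else sm_power (sm_transpose upsilon) (nat (- k)))"

definition laurent_upsilon :: "laurent \<Rightarrow> smat" where
  "laurent_upsilon L = (\<lambda>i j. \<Sum>k\<in>Poly_Mapping.keys L. Poly_Mapping.lookup L k * upsilon_powi k i j)"

text \<open>The \<open>k\<close>-th component of \<open>S \<chi>\<close> for lower triangular \<open>S\<close>.\<close>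

definition cmv_poly :: "smat \<Rightarrow> nat \<Rightarrow> complex \<Rightarrow> complex" where
  "cmv_poly S k z = (\<Sum>j\<le>k. S k j * cmv j z)"


section \<open>Second kind functions, kernels, perturbations, connectors\<close>

definition second_kind1 ::
    "(complex \<Rightarrow> complex) set \<Rightarrow> form \<Rightarrow> (nat \<Rightarrow> complex \<Rightarrow> complex) \<Rightarrow> nat \<Rightarrow> complex \<Rightarrow> complex" where
  "second_kind1 F u \<phi>1 k z = bracket F u (\<phi>1 k) (\<lambda>z2. 1 / (cnj z - z2))"

definition second_kind2 ::
    "(complex \<Rightarrow> complex) set \<Rightarrow> form \<Rightarrow> (nat \<Rightarrow> complex \<Rightarrow> complex) \<Rightarrow> nat \<Rightarrow> complex \<Rightarrow> complex" where
  "second_kind2 F u \<phi>2 k z = cnj (bracket F u (\<lambda>z1. 1 / (cnj z - z1)) (\<phi>2 k))"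

text \<open>\<open>cd_kernel H P Q l x1 x2\<close> is the kernel at \<open>(cnj x1, x2)\<close>: the sequence \<open>P\<close> is evaluated
  at \<open>x1\<close> and conjugated. The pure kernel has \<open>P = \<phi>2\<close>, \<open>Q = \<phi>1\<close>; the mixed ones
  replace \<open>P\<close> or \<open>Q\<close> by the second kind functions.\<close>

definition cd_kernel ::
    "(nat \<Rightarrow> complex) \<Rightarrow> (nat \<Rightarrow> complex \<Rightarrow> complex) \<Rightarrow> (nat \<Rightarrow> complex \<Rightarrow> complex) \<Rightarrow>
     nat \<Rightarrow> complex \<Rightarrow> complex \<Rightarrow> complex" where
  "cd_kernel H P Q l x1 x2 = (\<Sum>k<l. cnj (P k x1) * inverse (H k) * Q k x2)"

definition gu_form12 ::
    "(complex \<Rightarrow> complex) set \<Rightarrow> form \<Rightarrow> laurent \<Rightarrow> laurent \<Rightarrow>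
     nat \<Rightarrow> (nat \<Rightarrow> complex) \<Rightarrow> (nat \<Rightarrow> nat) \<Rightarrow> (nat \<Rightarrow> nat \<Rightarrow> (complex \<Rightarrow> complex) \<Rightarrow> complex) \<Rightarrow> form" where
  "gu_form12 F u L\<Gamma>1 LC2 d \<zeta> m \<xi> = (\<lambda>f g.
     bracket F u (\<lambda>z. f z / leval L\<Gamma>1 z) (\<lambda>z. leval LC2 z * g z) +
     (\<Sum>i=1..d. \<Sum>l<m i. 1 / fact l * (dz ^^ l) f (\<zeta> i) * cnj (\<xi> i l (\<lambda>z. leval LC2 z * g z))))"

definition gu_form21 ::
    "(complex \<Rightarrow> complex) set \<Rightarrow> form \<Rightarrow> laurent \<Rightarrow> laurent \<Rightarrow>
     nat \<Rightarrow> (nat \<Rightarrow> complex) \<Rightarrow> (nat \<Rightarrow> nat) \<Rightarrow> (nat \<Rightarrow> nat \<Rightarrow> (complex \<Rightarrow> complex) \<Rightarrow> complex) \<Rightarrow> form" where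
  "gu_form21 F u L\<Gamma>2 LC1 d \<zeta> m \<xi> = (\<lambda>f g.
     bracket F u (\<lambda>z. leval LC1 z * f z) (\<lambda>z. g z / leval L\<Gamma>2 z) +
     (\<Sum>i=1..d. \<Sum>l<m i. 1 / fact l * \<xi> i l (\<lambda>z. leval LC1 z * f z) * cnj ((dz ^^ l) g (\<zeta> i))))"

text \<open>\<open>connector S' L S\<close> is \<open>S' L(\<Upsilon>) S\<^sup>-\<^sup>1\<close>.\<close>

definition connector :: "smat \<Rightarrow> laurent \<Rightarrow> smat \<Rightarrow> smat" where
  "connector S' L S = sm_mult (sm_mult S' (laurent_upsilon L)) (sm_inv S)"

definition conn_Gamma :: "smat \<Rightarrow> nat \<Rightarrow> nat \<Rightarrow> complex Matrix.mat" where
  "conn_Gamma \<Omega> N\<Gamma> l = Matrix.mat (2 * N\<Gamma>) (2 * N\<Gamma>) (\<lambda>(i, j). \<Omega> (l + i) (l - 2 * N\<Gamma> + j))"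

definition conn_C :: "smat \<Rightarrow> nat \<Rightarrow> nat \<Rightarrow> complex Matrix.mat" where
  "conn_C \<Omega> NC l = Matrix.mat (2 * NC) (2 * NC) (\<lambda>(i, j). \<Omega> (l - 2 * NC + i) (l + j))"

definition conn_block12 :: "smat \<Rightarrow> nat \<Rightarrow> nat \<Rightarrow> nat \<Rightarrow> complex Matrix.mat" where
  "conn_block12 \<Omega> N\<Gamma> NC l =
     four_block_mat
       (0\<^sub>m (2 * NC) (2 * N\<Gamma>))             (map_mat cnj (conn_C \<Omega> NC l))
       (- map_mat cnj (conn_Gamma \<Omega> N\<Gamma> l)) (0\<^sub>m (2 * N\<Gamma>) (2 * NC))"

definition conn_block21 :: "smat \<Rightarrow> nat \<Rightarrow> nat \<Rightarrow> nat \<Rightarrow> complex Matrix.mat" where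
  "conn_block21 \<Omega> N\<Gamma> NC l =
     four_block_mat
       (0\<^sub>m (2 * NC) (2 * N\<Gamma>)) (conn_C \<Omega> NC l)
       (- conn_Gamma \<Omega> N\<Gamma> l)  (0\<^sub>m (2 * N\<Gamma>) (2 * NC))"

text \<open>The product \<open>row \<cdot> M \<cdot> column\<close> of the row \<open>[a(l - 2NC), \<dots>, a(l + 2N\<Gamma> - 1)]\<close>, the matrix
  \<open>M\<close> and the column \<open>[b(l - 2N\<Gamma>), \<dots>, b(l + 2NC - 1)]\<close>.\<close>

definition window_product ::
    "nat \<Rightarrow> nat \<Rightarrow> nat \<Rightarrow> (nat \<Rightarrow> complex) \<Rightarrow> complex Matrix.mat \<Rightarrow> (nat \<Rightarrow> complex) \<Rightarrow> complex" where
  "window_product N\<Gamma> NC l a M b =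
     scalar_prod (Matrix.vec (2 * NC + 2 * N\<Gamma>) (\<lambda>i. a (l - 2 * NC + i)))
       (mult_mat_vec M (Matrix.vec (2 * N\<Gamma> + 2 * NC) (\<lambda>j. b (l - 2 * N\<Gamma> + j))))"

end

theory Submission
  imports Defs "HOL-Complex_Analysis.Cauchy_Integral_Formula"
begin

text \<open>At the zeros of \<open>L\<^sub>\<Gamma>\<close> the function \<open>L\<^sub>\<Gamma> f\<close> vanishes to the order that kills the discrete part of
  the perturbed form, which therefore satisfies \<open>\<langle>L\<^sub>\<Gamma> f, g\<rangle>' = \<langle>f, L\<^sub>C g\<rangle>\<close>.
  By biorthogonality the same matrix \<open>\<Omega>\<close> gives both expansions
  \<open>L\<^sub>C \<phi>'\<^sub>2 = \<Omega> \<phi>\<^sub>2\<close> and \<open>L\<^sub>\<Gamma> \<phi>\<^sub>1 = H \<Omega>\<^sup>\<dagger> H'\<inverse> \<phi>'\<^sub>1\<close>. The difference of the two kernels is then a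
  sum over \<open>k < l, q\<close> minus the same sum over \<open>q < l, k\<close>; as \<open>\<Omega>\<close> is banded, only the window around
  \<open>l\<close> survives. With a Cauchy kernel in the first argument,
  \<open>L\<^sub>\<Gamma>(w) / (w - z) = \<delta>L\<^sub>\<Gamma>(w, z) + L\<^sub>\<Gamma>(z) / (w - z)\<close>, and the Laurent polynomial \<open>\<delta>L\<^sub>\<Gamma>(w, \<cdot>)\<close> has
  low enough degree to be reproduced by the perturbed kernel; this is the extra term in (i).
  Parts (ii) and (iv) are the complex conjugates of (iii) and (i) for the adjoint form
  \<open>cnj \<langle>g, f\<rangle>\<close>, which interchanges the two perturbations.\<close>

section \<open>Banded semi-infinite matrices and the CMV basis\<close>

text \<open>Only the upper side is bounded. Then every row is finite, so a product with an arbitrary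
  right factor is a finite sum, and lower triangular matrices are the case
  \<open>banded 0\<close>.\<close>

definition banded :: "nat \<Rightarrow> smat \<Rightarrow> bool" where
  "banded b A \<longleftrightarrow> (\<forall>i j. i + b < j \<longrightarrow> A i j = 0)"

lemma bandedD: "banded b A \<Longrightarrow> i + b < j \<Longrightarrow> A i j = 0"
  by (simp add: banded_def)

lemma sm_mult_eq_sum:
  assumes "banded b A" "i + b \<le> n"
  shows "sm_mult A B i j = (\<Sum>k\<le>n. A i k * B k j)"
  unfolding sm_mult_def
proof (rule Sum_any.expand_superset)
  show "{k. A i k * B k j \<noteq> 0} \<subseteq> {..n}"
    using bandedD[OF assms(1)] assms(2)
    by (smt (verit) atMost_iff le_trans linorder_not_less mem_Collect_eq mult_zero_left subsetI)
qed simp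

lemma banded_sm_mult:
  assumes "banded a A" "banded b B"
  shows "banded (a + b) (sm_mult A B)"
  unfolding banded_def
proof (intro allI impI)
  fix i j assume "i + (a + b) < j"
  moreover have "sm_mult A B i j = (\<Sum>k\<le>i + a. A i k * B k j)"
    by (rule sm_mult_eq_sum[OF assms(1)]) simp
  ultimately show "sm_mult A B i j = 0"
    using bandedD[OF assms(2)] by (auto intro!: sum.neutral)
qed

text \<open>Finite rows of \<open>A\<close> and \<open>B\<close> suffice to swap the two sums. The
  last factor stays arbitrary, so that it can be a full column such as
  \<open>cmv_column z\<close>.\<close>

lemma sm_mult_assoc:
  assumes "banded a A" "banded b B"
  shows "sm_mult (sm_mult A B) C = sm_mult A (sm_mult B C)"
proof (intro ext)
  fix i j
  let ?n = "i + a + b"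
  have "sm_mult (sm_mult A B) C i j = (\<Sum>k\<le>?n. (\<Sum>p\<le>i + a. A i p * B p k) * C k j)"
    by (subst sm_mult_eq_sum[OF banded_sm_mult[OF assms], where n = ?n])
       (auto simp: sm_mult_eq_sum[OF assms(1) order_refl])
  also have "\<dots> = (\<Sum>p\<le>i + a. A i p * (\<Sum>k\<le>?n. B p k * C k j))"
    by (simp add: sum_distrib_right sum_distrib_left mult.assoc) (rule sum.swap)
  also have "\<dots> = (\<Sum>p\<le>i + a. A i p * sm_mult B C p j)"
    by (intro sum.cong refl arg_cong2[where f = "(*)"]) (simp add: sm_mult_eq_sum[OF assms(2), where n = ?n])
  also have "\<dots> = sm_mult A (sm_mult B C) i j"
    by (simp add: sm_mult_eq_sum[OF assms(1) order_refl])
  finally show "sm_mult (sm_mult A B) C i j = sm_mult A (sm_mult B C) i j" .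
qed

lemma sm_mult_scale_right:
  assumes "banded b A"
  shows "sm_mult A (\<lambda>i j. c * B i j) = (\<lambda>i j. c * sm_mult A B i j)"
  by (intro ext) (simp add: sm_mult_eq_sum[OF assms order_refl] sum_distrib_left mult.left_commute)

lemma banded_sm_diag: "banded 0 (sm_diag H)"
  by (simp add: banded_def sm_diag_def)

lemma banded_sm_one: "banded 0 sm_one"
  by (simp add: banded_def sm_one_def)

lemma sm_mult_diag_left: "sm_mult (sm_diag H) B i j = H i * B i j"
  by (subst sm_mult_eq_sum[OF banded_sm_diag order_refl])
     (simp add: sm_diag_def if_distrib[of "\<lambda>x. x * _"] cong: if_cong)

lemma sm_mult_one_left [simp]: "sm_mult sm_one B = B"
  using sm_mult_diag_left[of "\<lambda>_. 1" B] by (simp add: fun_eq_iff sm_one_def sm_diag_def)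

lemma sm_mult_one_right:
  assumes "banded b A"
  shows "sm_mult A sm_one = A"
proof (intro ext)
  fix i j
  have "sm_mult A sm_one i j = (\<Sum>k\<le>i + b + j. A i k * sm_one k j)"
    by (rule sm_mult_eq_sum[OF assms]) simp
  also have "\<dots> = (\<Sum>k\<le>i + b + j. if k = j then A i k else 0)"
    by (rule sum.cong) (auto simp: sm_one_def)
  finally show "sm_mult A sm_one i j = A i j" by simp
qed

section \<open>Inverses of lower unitriangular matrices\<close>

lemma lower_unitriangular_banded: "lower_unitriangular S \<Longrightarrow> banded 0 S"
  by (simp add: lower_unitriangular_def banded_def)

fun forward_subst :: "smat \<Rightarrow> smat" where
  "forward_subst S i j =
     (if i < j then 0 else if i = j then 1 else - (\<Sum>k<i. S i k * forward_subst S k j))"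

declare forward_subst.simps [simp del]

lemma lower_unitriangular_forward_subst: "lower_unitriangular (forward_subst S)"
  by (simp add: lower_unitriangular_def forward_subst.simps)

lemma sm_mult_forward_subst:
  assumes "lower_unitriangular S"
  shows "sm_mult S (forward_subst S) = sm_one"
proof (intro ext)
  fix i j
  have S: "S i i = 1" using assms by (simp add: lower_unitriangular_def)
  have "sm_mult S (forward_subst S) i j = (\<Sum>k\<le>i. S i k * forward_subst S k j)"
    by (rule sm_mult_eq_sum[OF lower_unitriangular_banded[OF assms]]) simp
  also have "\<dots> = (\<Sum>k<i. S i k * forward_subst S k j) + forward_subst S i j"
    by (simp add: lessThan_Suc_atMost[symmetric] S)
  also have "\<dots> = sm_one i j"
  proof -
    have "(\<Sum>k<i. S i k * forward_subst S k j) = 0" if "i \<le> j"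
      using that by (intro sum.neutral) (simp add: forward_subst.simps)
    then show ?thesis
      by (cases i j rule: linorder_cases)
         (simp_all add: sm_one_def forward_subst.simps[of S i j] forward_subst.simps[of S j j])
  qed
  finally show "sm_mult S (forward_subst S) i j = sm_one i j" .
qed

text \<open>Forward substitution yields a right inverse T of S, and T has a right inverse R of its
  own. Then S = S (T R) = R, which makes T two-sided; the usual uniqueness argument identifies it
  with the described inverse.\<close>

lemma sm_inv:
  assumes "lower_unitriangular S"
  shows "lower_unitriangular (sm_inv S)" "sm_mult S (sm_inv S) = sm_one"
    "sm_mult (sm_inv S) S = sm_one"
proof -
  define T where "T = forward_subst S"
  note lub = lower_unitriangular_banded
  have T: "lower_unitriangular T" "sm_mult S T = sm_one"
    by (simp_all add: T_def lower_unitriangular_forward_subst sm_mult_forward_subst assms)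
  define R where "R = forward_subst T"
  have R: "lower_unitriangular R" "sm_mult T R = sm_one"
    by (simp_all add: R_def lower_unitriangular_forward_subst sm_mult_forward_subst T(1))
  have "S = sm_mult S (sm_mult T R)"
    by (simp add: R sm_mult_one_right[OF lub[OF assms]])
  also have "\<dots> = R"
    by (simp add: sm_mult_assoc[OF lub[OF assms] lub[OF T(1)], symmetric] T(2))
  finally have TS: "sm_mult T S = sm_one" using R(2) by simp
  have "sm_inv S = T"
    unfolding sm_inv_def
  proof (rule the_equality)
    fix T' assume T': "lower_unitriangular T' \<and> sm_mult S T' = sm_one \<and> sm_mult T' S = sm_one"
    then have "T' = sm_mult (sm_mult T S) T'" by (simp add: TS)
    also have "\<dots> = sm_mult T (sm_mult S T')"
      by (rule sm_mult_assoc[OF lub[OF T(1)] lub[OF assms]])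
    also have "\<dots> = T" using T' by (simp add: sm_mult_one_right[OF lub[OF T(1)]])
    finally show "T' = T" .
  qed (simp add: T TS)
  then show "lower_unitriangular (sm_inv S)" "sm_mult S (sm_inv S) = sm_one"
    "sm_mult (sm_inv S) S = sm_one" by (simp_all add: T TS)
qed

section \<open>The shift matrix acting on the CMV basis\<close>

text \<open>The vector of basis values is encoded as a matrix with equal columns, so that
  associativity of \<open>sm_mult\<close> covers matrix-vector products as well.\<close>

definition cmv_column :: "complex \<Rightarrow> smat" where
  "cmv_column z = (\<lambda>j _. cmv j z)"

lemma cmv_poly_eq_sm_mult:
  assumes "lower_unitriangular S"
  shows "cmv_poly S k z = sm_mult S (cmv_column z) k j"
  by (simp add: sm_mult_eq_sum[OF lower_unitriangular_banded[OF assms], of k k]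
      cmv_poly_def cmv_column_def)

lemma banded_upsilon: "banded 2 upsilon" "banded 2 (sm_transpose upsilon)"
  by (auto simp: banded_def upsilon_def sm_transpose_def)

lemma upsilon_cmv_column:
  assumes "z \<noteq> 0"
  shows "sm_mult upsilon (cmv_column z) = (\<lambda>i j. z * cmv_column z i j)"
proof (intro ext)
  fix i j
  have "sm_mult upsilon (cmv_column z) i j = (\<Sum>k\<le>i + 2. upsilon i k * cmv k z)"
    by (simp add: sm_mult_eq_sum[OF banded_upsilon(1) order_refl] cmv_column_def)
  also have "\<dots> = z * cmv i z"
  \<comment> \<open>Each row of \<open>upsilon\<close> has a single entry 1. Even rows raise a
    nonnegative power, row 1 sends the power -1 to the power 0, and the other odd rows step back to
    the preceding negative power.\<close>
  proof (cases "even i")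
    case True
    then have "(\<Sum>k\<le>i + 2. upsilon i k * cmv k z) = (\<Sum>k\<le>i + 2. if k = i + 2 then cmv k z else 0)"
      by (intro sum.cong) (auto simp: upsilon_def)
    then show ?thesis using True assms
      by (simp add: cmv_def power_int_add add.commute)
  next
    case odd: False
    show ?thesis
    proof (cases "i = 1")
      case True
      have "(\<Sum>k\<le>i + 2. upsilon i k * cmv k z) = (\<Sum>k\<le>i + 2. if k = 0 then cmv k z else 0)"
        using True by (intro sum.cong) (auto simp: upsilon_def)
      then show ?thesis using True assms by (simp add: cmv_def power_int_minus)
    next
      case False
      then obtain n where n: "i = n + 2" "odd n" using odd
        by (metis Suc_1 add_2_eq_Suc' even_Suc even_add not0_implies_Suc odd_one One_nat_def even_zero)
      have "(\<Sum>k\<le>i + 2. upsilon i k * cmv k z) = (\<Sum>k\<le>i + 2. if k = n then cmv k z else 0)"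
        using n by (intro sum.cong) (auto simp: upsilon_def)
      also have "\<dots> = cmv n z" using n by simp
      also have "\<dots> = z * cmv i z"
      proof -
        have "z powi (- int (n div 2) - 1) = z powi (1 + (- int (i div 2) - 1))" using n
          by (intro arg_cong[where f = "(powi) z"]) simp
        also have "\<dots> = z * z powi (- int (i div 2) - 1)"
          using assms by (subst power_int_add) simp_all
        finally show ?thesis using n by (simp add: cmv_def)
      qed
      finally show ?thesis .
    qed
  qed
  finally show "sm_mult upsilon (cmv_column z) i j = z * cmv_column z i j"
    by (simp add: cmv_column_def)
qed

lemma transpose_upsilon_upsilon: "sm_mult (sm_transpose upsilon) upsilon = sm_one"
proof (intro ext)
  fix i j :: nat
  consider "i = 0" | n where "i = 2 * n + 2" | n where "i = 2 * n + 1"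
    by (cases i; metis Suc_eq_plus1 add_2_eq_Suc' evenE mult_Suc_right oddE even_Suc add.commute)
  \<comment> \<open>Column i of \<open>upsilon\<close> has its only nonzero entry in row p: row 1
    for column 0, row 2n for column 2n+2, row 2n+3 for column 2n+1.\<close>
  then obtain p where p: "p \<le> i + 2" "\<And>k. upsilon k i = (if k = p then 1 else 0)"
    "upsilon p j = (if i = j then 1 else 0)"
  proof cases
    case 1
    show ?thesis by (rule that[of 1]) (use 1 in \<open>auto simp: upsilon_def\<close>)
  next
    case (2 n)
    show ?thesis by (rule that[of "2 * n"]) (use 2 in \<open>auto simp: upsilon_def\<close>)
  next
    case (3 n)
    have "(even k \<and> i = k + 2 \<or> k = 1 \<and> i = 0 \<or> odd k \<and> k = i + 2) = (k = 2 * n + 3)" for k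
      using 3 by presburger
    then have "upsilon k i = (if k = 2 * n + 3 then 1 else 0)" for k
      by (simp only: upsilon_def)
    then show ?thesis by (rule that[of "2 * n + 3", rotated]) (use 3 in \<open>auto simp: upsilon_def\<close>)
  qed
  have "sm_mult (sm_transpose upsilon) upsilon i j =
      (\<Sum>k\<le>i + 2. if k = p then upsilon k j else 0)"
    unfolding sm_mult_eq_sum[OF banded_upsilon(2) order_refl]
    by (intro sum.cong) (auto simp: sm_transpose_def p(2))
  also have "\<dots> = sm_one i j"
    using p(1,3) by (simp add: sm_one_def del: sum.atMost_Suc add_2_eq_Suc')
  finally show "sm_mult (sm_transpose upsilon) upsilon i j = sm_one i j" .
qed

lemma transpose_upsilon_cmv_column:
  assumes "z \<noteq> 0"
  shows "sm_mult (sm_transpose upsilon) (cmv_column z) = (\<lambda>i j. inverse z * cmv_column z i j)"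
proof -
  have "cmv_column z = (\<lambda>i j. inverse z * sm_mult upsilon (cmv_column z) i j)"
    using assms by (simp add: upsilon_cmv_column fun_eq_iff)
  then have "sm_mult (sm_transpose upsilon) (cmv_column z) =
      sm_mult (sm_transpose upsilon) (\<lambda>i j. inverse z * sm_mult upsilon (cmv_column z) i j)"
    by simp
  also have "\<dots> = (\<lambda>i j. inverse z * cmv_column z i j)"
    by (simp add: sm_mult_scale_right[OF banded_upsilon(2)]
        sm_mult_assoc[OF banded_upsilon(2,1), symmetric] transpose_upsilon_upsilon)
  finally show ?thesis .
qed

lemma banded_sm_power:
  assumes "banded b A"
  shows "banded (n * b) (sm_power A n)"
  by (induction n) (simp_all add: banded_sm_one banded_sm_mult[OF assms])

lemma sm_power_eigen:
  assumes "banded b A" "sm_mult A X = (\<lambda>i j. c * X i j)"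
  shows "sm_mult (sm_power A n) X = (\<lambda>i j. c ^ n * X i j)"
proof (induction n)
  case (Suc n)
  have "sm_mult (sm_power A (Suc n)) X = sm_mult A (sm_mult (sm_power A n) X)"
    by (simp add: sm_mult_assoc[OF assms(1) banded_sm_power[OF assms(1)]])
  also have "\<dots> = (\<lambda>i j. c ^ n * (c * X i j))"
    by (simp only: Suc sm_mult_scale_right[OF assms(1)] assms(2))
  finally show ?case by (simp add: fun_eq_iff)
qed simp

lemma banded_upsilon_powi: "banded (2 * nat \<bar>k\<bar>) (upsilon_powi k)"
  using banded_sm_power[OF banded_upsilon(1), of "nat k"]
    banded_sm_power[OF banded_upsilon(2), of "nat (- k)"]
  by (auto simp: upsilon_powi_def mult.commute)

lemma upsilon_powi_cmv_column:
  assumes "z \<noteq> 0"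
  shows "sm_mult (upsilon_powi k) (cmv_column z) i j = z powi k * cmv i z"
  using sm_power_eigen[OF banded_upsilon(1) upsilon_cmv_column[OF assms], of "nat k"]
    sm_power_eigen[OF banded_upsilon(2) transpose_upsilon_cmv_column[OF assms], of "nat (- k)"]
  by (simp add: upsilon_powi_def power_int_def cmv_column_def)

section \<open>Laurent polynomials of the shift and connectors\<close>

text \<open>A symmetric range of exponents fits the CMV order: multiplication by z or by its inverse
  moves the index by at most 2 upwards, so such an L has upper bandwidth 2N.\<close>

definition laurent_bound :: "laurent \<Rightarrow> nat \<Rightarrow> bool" where
  "laurent_bound L N \<longleftrightarrow> Poly_Mapping.keys L \<subseteq> {- int N..int N}"

lemma laurent_degrees_bound: "laurent_degrees L Np Nm \<Longrightarrow> laurent_bound L (max Np Nm)"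
  by (fastforce simp: laurent_degrees_def laurent_bound_def)

lemma banded_laurent_upsilon:
  assumes "laurent_bound L N"
  shows "banded (2 * N) (laurent_upsilon L)"
  unfolding banded_def laurent_upsilon_def
proof (intro allI impI sum.neutral ballI)
  fix i j k assume "i + 2 * N < j" "k \<in> Poly_Mapping.keys L"
  then have "i + 2 * nat \<bar>k\<bar> < j"
    using assms by (fastforce simp: laurent_bound_def)
  then show "Poly_Mapping.lookup L k * upsilon_powi k i j = 0"
    using bandedD[OF banded_upsilon_powi] by simp
qed

lemma laurent_upsilon_cmv_column:
  assumes "laurent_bound L N" "z \<noteq> 0"
  shows "sm_mult (laurent_upsilon L) (cmv_column z) = (\<lambda>i j. leval L z * cmv_column z i j)"
proof (intro ext)
  fix i j
  let ?K = "Poly_Mapping.keys L" and ?c = "Poly_Mapping.lookup L"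
  have "sm_mult (laurent_upsilon L) (cmv_column z) i j =
      (\<Sum>q\<le>i + 2 * N. (\<Sum>k\<in>?K. ?c k * upsilon_powi k i q) * cmv_column z q j)"
    by (subst sm_mult_eq_sum[OF banded_laurent_upsilon[OF assms(1)] order_refl])
       (simp add: laurent_upsilon_def)
  also have "\<dots> = (\<Sum>k\<in>?K. ?c k * (\<Sum>q\<le>i + 2 * N. upsilon_powi k i q * cmv_column z q j))"
    by (simp add: sum_distrib_right sum_distrib_left mult.assoc) (rule sum.swap)
  also have "\<dots> = (\<Sum>k\<in>?K. ?c k * (z powi k * cmv i z))"
  proof (intro sum.cong refl arg_cong2[where f = "(*)"])
    fix k assume "k \<in> ?K"
    then have "i + 2 * nat \<bar>k\<bar> \<le> i + 2 * N" using assms(1) by (fastforce simp: laurent_bound_def)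
    then show "(\<Sum>q\<le>i + 2 * N. upsilon_powi k i q * cmv_column z q j) = z powi k * cmv i z"
      by (simp add: sm_mult_eq_sum[OF banded_upsilon_powi, symmetric] upsilon_powi_cmv_column assms(2))
  qed
  also have "\<dots> = leval L z * cmv_column z i j"
    by (simp add: leval_def cmv_column_def sum_distrib_right mult.assoc)
  finally show "sm_mult (laurent_upsilon L) (cmv_column z) i j = leval L z * cmv_column z i j" .
qed

text \<open>This is the degree count: multiplication by L enlarges the CMV span by at most 2N basis
  functions. It later gives the lower band of the connector.\<close>

lemma leval_mult_cmv_poly:
  assumes "laurent_bound L N" "lower_unitriangular S" "z \<noteq> 0"
  shows "leval L z * cmv_poly S k z =
    (\<Sum>q\<le>k + 2 * N. sm_mult S (laurent_upsilon L) k q * cmv q z)"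
proof -
  note S = lower_unitriangular_banded[OF assms(2)] and L = banded_laurent_upsilon[OF assms(1)]
  have "leval L z * cmv_poly S k z = sm_mult S (\<lambda>i j. leval L z * cmv_column z i j) k 0"
    by (simp add: sm_mult_scale_right[OF S] cmv_poly_eq_sm_mult[OF assms(2), of k z 0])
  also have "\<dots> = sm_mult (sm_mult S (laurent_upsilon L)) (cmv_column z) k 0"
    by (simp add: sm_mult_assoc[OF S L] laurent_upsilon_cmv_column[OF assms(1,3)])
  also have "\<dots> = (\<Sum>q\<le>k + 2 * N. sm_mult S (laurent_upsilon L) k q * cmv q z)"
    by (subst sm_mult_eq_sum[OF banded_sm_mult[OF S L], of k "k + 2 * N"]) (simp_all add: cmv_column_def)
  finally show ?thesis .
qed

lemma banded_connector:
  assumes "laurent_bound L N" "lower_unitriangular S'" "lower_unitriangular S"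
  shows "banded (2 * N) (connector S' L S)"
  using banded_sm_mult[OF banded_sm_mult[OF lower_unitriangular_banded[OF assms(2)]
      banded_laurent_upsilon[OF assms(1)]] lower_unitriangular_banded[OF sm_inv(1)[OF assms(3)]]]
  by (simp add: connector_def)

text \<open>The trailing inverse in the connector cancels against S, leaving S' L(\<Upsilon>)
  applied to the basis column, on which L(\<Upsilon>) acts as the scalar L(z).\<close>

lemma leval_mult_cmv_poly_connector:
  assumes "laurent_bound L N" "lower_unitriangular S'" "lower_unitriangular S" "z \<noteq> 0"
  shows "leval L z * cmv_poly S' k z = (\<Sum>q\<le>k + 2 * N. connector S' L S k q * cmv_poly S q z)"
proof -
  note S = lower_unitriangular_banded[OF assms(3)] and S' = lower_unitriangular_banded[OF assms(2)]
    and L = banded_laurent_upsilon[OF assms(1)]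
    and SI = lower_unitriangular_banded[OF sm_inv(1)[OF assms(3)]]
  have "(\<Sum>q\<le>k + 2 * N. connector S' L S k q * cmv_poly S q z) =
      sm_mult (connector S' L S) (sm_mult S (cmv_column z)) k 0"
    by (simp add: sm_mult_eq_sum[OF banded_connector[OF assms(1-3)] order_refl]
        cmv_poly_eq_sm_mult[OF assms(3), of _ z 0])
  also have "\<dots> = sm_mult (sm_mult S' (laurent_upsilon L)) (sm_mult (sm_mult (sm_inv S) S) (cmv_column z)) k 0"
    by (simp only: connector_def sm_mult_assoc[OF banded_sm_mult[OF S' L] SI] sm_mult_assoc[OF SI S])
  also have "\<dots> = sm_mult S' (\<lambda>i j. leval L z * cmv_column z i j) k 0"
    by (simp add: sm_inv(3)[OF assms(3)] sm_mult_assoc[OF S' L] laurent_upsilon_cmv_column[OF assms(1,4)])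
  also have "\<dots> = leval L z * cmv_poly S' k z"
    by (simp add: sm_mult_scale_right[OF S'] cmv_poly_eq_sm_mult[OF assms(2), of k z 0])
  finally show ?thesis by simp
qed

lemma cmv_eq_sum_cmv_poly:
  assumes "lower_unitriangular S"
  shows "cmv j z = (\<Sum>k\<le>j. sm_inv S j k * cmv_poly S k z)"
proof -
  note S = lower_unitriangular_banded[OF assms]
    and SI = lower_unitriangular_banded[OF sm_inv(1)[OF assms]]
  have "cmv j z = sm_mult (sm_mult (sm_inv S) S) (cmv_column z) j 0"
    by (simp add: sm_inv(3)[OF assms] cmv_column_def)
  also have "\<dots> = sm_mult (sm_inv S) (sm_mult S (cmv_column z)) j 0"
    by (simp add: sm_mult_assoc[OF SI S])
  also have "\<dots> = (\<Sum>k\<le>j. sm_inv S j k * cmv_poly S k z)"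
    by (simp add: sm_mult_eq_sum[OF SI, of j j] cmv_poly_eq_sm_mult[OF assms, of _ z 0])
  finally show ?thesis .
qed


section \<open>Difference quotients of Laurent polynomials\<close>

lemma leval_eq_sum_superset:
  assumes "finite A" "Poly_Mapping.keys L \<subseteq> A"
  shows "leval L z = (\<Sum>k\<in>A. Poly_Mapping.lookup L k * z powi k)"
  unfolding leval_def using assms
  by (intro sum.mono_neutral_left) (auto simp: in_keys_iff)

lemma leval_single: "leval (Poly_Mapping.single n c) z = c * z powi n"
  by (subst leval_eq_sum_superset[of "{n}"]) auto

lemma leval_add: "leval (L + M) z = leval L z + leval M z"
proof -
  let ?A = "Poly_Mapping.keys L \<union> Poly_Mapping.keys M"
  have "leval (L + M) z = (\<Sum>k\<in>?A. Poly_Mapping.lookup (L + M) k * z powi k)"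
    by (rule leval_eq_sum_superset) (simp_all add: Poly_Mapping.keys_add)
  also have "\<dots> = leval L z + leval M z"
    by (simp add: leval_eq_sum_superset[of ?A] lookup_add distrib_right sum.distrib)
  finally show ?thesis .
qed

lemma holomorphic_on_leval: "leval L holomorphic_on (- {0})"
  unfolding leval_def by (intro holomorphic_intros) auto

text \<open>Off the diagonal the equation determines D. On the diagonal, continuity of D at w makes
  D w the limit of the difference quotients, hence the derivative.\<close>

lemma diff_quot_unique:
  assumes "open S" "w \<in> S" "z \<in> S" "f holomorphic_on S" "continuous_on S D"
    and "\<And>y. y \<in> S \<Longrightarrow> (w - y) * D y = f w - f y"
  shows "diff_quot f w z = D z"
proof (cases "w = z")
  case True
  have "(f has_field_derivative D w) (at w)"
    unfolding has_field_derivative_iff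
  proof (rule Lim_transform_eventually)
    show "(D \<longlongrightarrow> D w) (at w)"
      using assms(1,2,5) by (simp add: continuous_on_eq_continuous_at isCont_def)
    have "\<forall>\<^sub>F y in at w. y \<in> S \<and> y \<noteq> w"
      using assms(1,2) by (intro eventually_conj eventually_at_in_open' eventually_neq_at_within) auto
    then show "\<forall>\<^sub>F y in at w. D y = (f y - f w) / (y - w)"
    proof (rule eventually_mono)
      fix y assume y: "y \<in> S \<and> y \<noteq> w"
      then have "f y - f w = D y * (y - w)" using assms(6)[of y] by (simp add: algebra_simps)
      then show "D y = (f y - f w) / (y - w)" using y by simp
    qed
  qed
  then show ?thesis using True by (simp add: diff_quot_def DERIV_imp_deriv)
next
  case False
  then show ?thesis using assms(6)[OF assms(3)] by (simp add: diff_quot_def field_simps)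
qed

section \<open>CMV coefficients of the difference quotient\<close>

lemma cmv_even: "cmv (2 * n) z = z ^ n"
  by (simp add: cmv_def)

lemma cmv_odd: "cmv (Suc (2 * n)) z = z powi (- int (Suc n))"
proof -
  have "cmv (Suc (2 * n)) z = z powi (- int n - 1)" by (simp add: cmv_def)
  also have "- int n - 1 = - int (Suc n)" by simp
  finally show ?thesis .
qed

lemma continuous_on_cmv: "continuous_on (- {0}) (cmv k)"
  unfolding cmv_def by (cases "even k") (auto intro!: continuous_intros)

text \<open>Induction by w^(n+1) - z^(n+1) = w (w^n - z^n) + (w - z) z^n. The new power z^n has CMV
  index 2n, so the length grows by 2 in each step.\<close>

lemma powi_diff_cmv_pos:
  "\<exists>c. \<forall>z. (w - z) * (\<Sum>j<2 * n. c j * cmv j z) = w ^ n - z ^ n"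
proof (induction n)
  case (Suc n)
  then obtain c where c: "\<And>z. (w - z) * (\<Sum>j<2 * n. c j * cmv j z) = w ^ n - z ^ n"
    by blast
  define c' where "c' j = (if j = 2 * n then 1 else if j < 2 * n then w * c j else 0)" for j
  have "(w - z) * (\<Sum>j<2 * Suc n. c' j * cmv j z) = w ^ Suc n - z ^ Suc n" for z
  proof -
    have "(\<Sum>j<2 * Suc n. c' j * cmv j z) = w * (\<Sum>j<2 * n. c j * cmv j z) + z ^ n"
      by (simp add: c'_def sum_distrib_left mult.assoc cmv_even)
    then have "(w - z) * (\<Sum>j<2 * Suc n. c' j * cmv j z) =
        w * ((w - z) * (\<Sum>j<2 * n. c j * cmv j z)) + (w - z) * z ^ n"
      by (simp only: algebra_simps)
    then show ?thesis by (simp only: c) (simp add: algebra_simps)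
  qed
  then show ?case by blast
qed simp

text \<open>Induction by w^(-n-1) - z^(-n-1) = w^(-1) (w^(-n) - z^(-n)) - (w - z) w^(-1) z^(-n-1).
  The new power z^(-n-1) has CMV index 2n+1.\<close>

lemma powi_diff_cmv_neg:
  assumes "w \<noteq> 0"
  shows "\<exists>c. \<forall>z. z \<noteq> 0 \<longrightarrow>
    (w - z) * (\<Sum>j<2 * n. c j * cmv j z) = w powi (- int n) - z powi (- int n)"
proof (induction n)
  case (Suc n)
  then obtain c where
    c: "\<And>z. z \<noteq> 0 \<Longrightarrow> (w - z) * (\<Sum>j<2 * n. c j * cmv j z) = w powi (- int n) - z powi (- int n)"
    by blast
  define c' where
    "c' j = (if j = 2 * n + 1 then - inverse w else if j < 2 * n then inverse w * c j else 0)" for j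
  have "(w - z) * (\<Sum>j<2 * Suc n. c' j * cmv j z) = w powi (- int (Suc n)) - z powi (- int (Suc n))"
    if z: "z \<noteq> 0" for z
  proof -
    have e: "y powi (- int (Suc n)) = inverse y * y powi (- int n)" if "y \<noteq> 0" for y :: complex
      using that power_int_add[of y "-1" "- int n"] by (simp add: power_int_minus)
    have sum: "(\<Sum>j<2 * Suc n. c' j * cmv j z) =
        inverse w * (\<Sum>j<2 * n. c j * cmv j z) - inverse w * z powi (- int (Suc n))"
      by (simp add: c'_def sum_distrib_left mult.assoc cmv_odd del: of_nat_Suc)
    have ring: "(w - z) * (i * s - i * (j * b)) = i * ((w - z) * s) - (w - z) * i * j * b" for i j s b
      by (simp add: algebra_simps)
    have field: "inverse w * (a - b) - (w - z) * inverse w * inverse z * b =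
        inverse w * a - inverse z * b" for a b
      using z assms by (simp add: field_simps)
    show ?thesis
      unfolding sum e[OF z] e[OF assms] ring c[OF z] field ..
  qed
  then show ?case by blast
qed simp

lemma powi_diff_cmv:
  assumes "w \<noteq> 0" "\<bar>k\<bar> \<le> int N"
  shows "\<exists>c. \<forall>z. z \<noteq> 0 \<longrightarrow> (w - z) * (\<Sum>j<2 * N. c j * cmv j z) = w powi k - z powi k"
proof -
  obtain n where n: "k = int n \<or> k = - int n" "n \<le> N"
    by (rule that[of "nat \<bar>k\<bar>"]) (use assms(2) in auto)
  have "\<exists>c. \<forall>z. z \<noteq> 0 \<longrightarrow> (w - z) * (\<Sum>j<2 * n. c j * cmv j z) = w powi k - z powi k"
    using n(1)
  proof
    assume "k = int n"
    then show ?thesis using powi_diff_cmv_pos[of w n] by (simp only: power_int_of_nat) blast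
  next
    assume "k = - int n"
    then show ?thesis using powi_diff_cmv_neg[OF assms(1), of n] by (simp only:)
  qed
  then obtain c where
    c: "\<And>z. z \<noteq> 0 \<Longrightarrow> (w - z) * (\<Sum>j<2 * n. c j * cmv j z) = w powi k - z powi k"
    by blast
  \<comment> \<open>Padding by zeros gives all exponents the common length 2N, so that their
    coefficients can be combined linearly for a whole Laurent polynomial.\<close>
  have "(\<Sum>j<2 * N. (if j < 2 * n then c j else 0) * cmv j z) = (\<Sum>j<2 * n. c j * cmv j z)" for z
    using n(2) by (intro sum.mono_neutral_cong_right) auto
  then have "\<forall>z. z \<noteq> 0 \<longrightarrow>
      (w - z) * (\<Sum>j<2 * N. (if j < 2 * n then c j else 0) * cmv j z) = w powi k - z powi k"
    by (simp add: c)
  then show ?thesis by (rule exI[of _ "\<lambda>j. if j < 2 * n then c j else 0"])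
qed

lemma leval_diff_cmv:
  assumes "laurent_bound L N" "w \<noteq> 0"
  shows "\<exists>c. \<forall>z. z \<noteq> 0 \<longrightarrow> (w - z) * (\<Sum>j<2 * N. c j * cmv j z) = leval L w - leval L z"
proof -
  let ?K = "Poly_Mapping.keys L" and ?a = "Poly_Mapping.lookup L"
  have "\<forall>k\<in>?K. \<exists>c. \<forall>z. z \<noteq> 0 \<longrightarrow> (w - z) * (\<Sum>j<2 * N. c j * cmv j z) = w powi k - z powi k"
    using assms by (intro ballI powi_diff_cmv) (force simp: laurent_bound_def)+
  from bchoice[OF this] obtain c where c: "\<And>k z. k \<in> ?K \<Longrightarrow> z \<noteq> 0 \<Longrightarrow>
      (w - z) * (\<Sum>j<2 * N. c k j * cmv j z) = w powi k - z powi k"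
    by blast
  have "(w - z) * (\<Sum>j<2 * N. (\<Sum>k\<in>?K. ?a k * c k j) * cmv j z) = leval L w - leval L z"
    if "z \<noteq> 0" for z
  proof -
    have "(\<Sum>j<2 * N. (\<Sum>k\<in>?K. ?a k * c k j) * cmv j z) =
        (\<Sum>k\<in>?K. ?a k * (\<Sum>j<2 * N. c k j * cmv j z))"
      by (simp add: sum_distrib_left sum_distrib_right mult.assoc) (rule sum.swap)
    then have "(w - z) * (\<Sum>j<2 * N. (\<Sum>k\<in>?K. ?a k * c k j) * cmv j z) =
        (\<Sum>k\<in>?K. ?a k * ((w - z) * (\<Sum>j<2 * N. c k j * cmv j z)))"
      by (simp only: sum_distrib_left[of "w - z" _ ?K] mult.left_commute[of "w - z"])
    also have "\<dots> = leval L w - leval L z"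
      using that by (simp add: c leval_def right_diff_distrib sum_subtractf)
    finally show ?thesis .
  qed
  then show ?thesis by (intro exI[of _ "\<lambda>j. \<Sum>k\<in>?K. ?a k * c k j"]) simp
qed


section \<open>Derivatives of fundamental functions\<close>

lemma dz_cong:
  assumes "open S" "z \<in> S" "\<And>y. y \<in> S \<Longrightarrow> f y = g y"
  shows "dz f z = dz g z"
proof -
  have "(f has_derivative D) (at z) \<longleftrightarrow> (g has_derivative D) (at z)" for D
    using has_derivative_transform_within_open[OF _ assms(1,2)] assms(3) by metis
  then show ?thesis by (simp add: dz_def frechet_derivative_def)
qed

lemma dz_eq:
  assumes "(f has_derivative D) (at z)"
  shows "dz f z = (D 1 - \<i> * D \<i>) / 2"
  by (simp add: dz_def frechet_derivative_at[OF assms, symmetric])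

text \<open>The Frechet derivative \<open>D\<close> of f is only real linear. The holomorphic factor
  contributes the complex linear map h -> a' h, which the combination in \<open>dz\<close> returns
  as a'.\<close>

lemma dz_mult_holomorphic:
  assumes "(a has_field_derivative a') (at z)" "f differentiable (at z)"
  shows "(\<lambda>y. a y * f y) differentiable (at z)"
    "dz (\<lambda>y. a y * f y) z = a' * f z + a z * dz f z"
proof -
  define D where "D = frechet_derivative f (at z)"
  have f: "(f has_derivative D) (at z)"
    unfolding D_def using assms(2) by (simp add: frechet_derivative_works)
  have af: "((\<lambda>y. a y * f y) has_derivative (\<lambda>h. a z * D h + a' * h * f z)) (at z)"
    by (rule has_derivative_mult[OF assms(1)[unfolded has_field_derivative_def] f])
  then show "(\<lambda>y. a y * f y) differentiable (at z)" by (auto simp: differentiable_def)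
  show "dz (\<lambda>y. a y * f y) z = a' * f z + a z * dz f z"
    unfolding dz_eq[OF af] dz_eq[OF f] by (simp add: field_simps)
qed

lemma dz_sum:
  assumes "finite I" "\<And>i. i \<in> I \<Longrightarrow> f i differentiable (at z)"
  shows "dz (\<lambda>y. \<Sum>i\<in>I. f i y) z = (\<Sum>i\<in>I. dz (f i) z)"
proof -
  have D: "(f i has_derivative frechet_derivative (f i) (at z)) (at z)" if "i \<in> I" for i
    using assms(2)[OF that] by (simp add: frechet_derivative_works)
  show ?thesis
    by (subst dz_eq[OF has_derivative_sum[OF D]])
       (simp_all add: dz_def sum_divide_distrib[symmetric] sum_subtractf sum_distrib_left)
qed

text \<open>Only the shape of the Leibniz expansion matters below, so the binomial coefficients
  stay anonymous.\<close>

lemma higher_dz_mult_holomorphic: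
  assumes S: "open S" and a: "a holomorphic_on S"
    and f: "\<And>n z. z \<in> S \<Longrightarrow> (dz ^^ n) f differentiable (at z)"
  shows "\<exists>c. \<forall>z\<in>S. (dz ^^ n) (\<lambda>y. a y * f y) z =
    (\<Sum>j\<le>n. c j * (deriv ^^ j) a z * (dz ^^ (n - j)) f z)"
proof (induction n)
  case 0
  show ?case by (rule exI[of _ "\<lambda>_. 1"]) simp
next
  case (Suc n)
  then obtain c where c: "\<And>z. z \<in> S \<Longrightarrow> (dz ^^ n) (\<lambda>y. a y * f y) z =
    (\<Sum>j\<le>n. c j * (deriv ^^ j) a z * (dz ^^ (n - j)) f z)" by blast
  \<comment> \<open>Pascal's rule: differentiating the factor a moves a term from j to j+1,
    differentiating f leaves it at j.\<close>
  define c' where "c' j = (if j = 0 then 0 else c (j - 1)) + (if j \<le> n then c j else 0)" for j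
  have "(dz ^^ Suc n) (\<lambda>y. a y * f y) z =
      (\<Sum>j\<le>Suc n. c' j * (deriv ^^ j) a z * (dz ^^ (Suc n - j)) f z)" (is "?l = ?r") if z: "z \<in> S" for z
  proof -
    let ?a = "\<lambda>j. (deriv ^^ j) a" and ?f = "\<lambda>j. (dz ^^ j) f"
    have da: "((\<lambda>y. c j * ?a j y) has_field_derivative c j * ?a (Suc j) z) (at z)" for j
      using holomorphic_derivI[OF holomorphic_higher_deriv[OF a S] S z, of j]
      by (auto intro!: DERIV_cmult)
    have "?l = dz (\<lambda>y. \<Sum>j\<le>n. (c j * ?a j y) * ?f (n - j) y) z"
      using dz_cong[OF S z c] by simp
    also have "\<dots> = (\<Sum>j\<le>n. dz (\<lambda>y. (c j * ?a j y) * ?f (n - j) y) z)"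
      by (rule dz_sum) (auto intro: dz_mult_holomorphic(1)[OF da] f z)
    also have "\<dots> = (\<Sum>j\<le>n. c j * ?a (Suc j) z * ?f (n - j) z + c j * ?a j z * ?f (Suc n - j) z)"
      by (intro sum.cong refl) (simp add: dz_mult_holomorphic(2)[OF da f[OF z]] Suc_diff_le)
    also have "\<dots> = (\<Sum>j\<le>n. c j * ?a (Suc j) z * ?f (Suc n - Suc j) z) +
        (\<Sum>j\<le>n. c j * ?a j z * ?f (Suc n - j) z)"
      by (simp add: sum.distrib)
    also have "(\<Sum>j\<le>n. c j * ?a (Suc j) z * ?f (Suc n - Suc j) z) =
        (\<Sum>j\<le>Suc n. (if j = 0 then 0 else c (j - 1)) * ?a j z * ?f (Suc n - j) z)"
      by (subst sum.atMost_Suc_shift) simp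
    also have "(\<Sum>j\<le>n. c j * ?a j z * ?f (Suc n - j) z) =
        (\<Sum>j\<le>Suc n. (if j \<le> n then c j else 0) * ?a j z * ?f (Suc n - j) z)"
      by simp
    finally show ?thesis
      by (simp only: c'_def distrib_right sum.distrib)
  qed
  then show ?case by blast
qed

lemma higher_deriv_leval_eq_0:
  assumes "j < lmult L z"
  shows "(deriv ^^ j) (leval L) z = 0"
  using not_less_Least[of j "\<lambda>m. (deriv ^^ m) (leval L) z \<noteq> 0"] assms by (auto simp: lmult_def)

context fundamental_space
begin

lemma higher_dz_closed: "f \<in> F \<Longrightarrow> (dz ^^ n) f \<in> F"
  by (induction n) (auto intro: dz)

text \<open>Every term of the Leibniz expansion contains a derivative of L of order at most n, and
  these vanish below the multiplicity.\<close>

lemma higher_dz_leval_mult_eq_0: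
  assumes "f \<in> F" "z \<noteq> 0" "n < lmult L z"
  shows "(dz ^^ n) (\<lambda>y. leval L y * f y) z = 0"
proof -
  obtain c where c: "\<And>z. z \<in> - {0} \<Longrightarrow> (dz ^^ n) (\<lambda>y. leval L y * f y) z =
      (\<Sum>j\<le>n. c j * (deriv ^^ j) (leval L) z * (dz ^^ (n - j)) f z)"
    using higher_dz_mult_holomorphic[OF open_Compl[OF closed_singleton] holomorphic_on_leval, of f n L]
      differentiable[OF higher_dz_closed[OF assms(1)]] by auto
  show ?thesis
    using assms(2,3) by (simp add: c higher_deriv_leval_eq_0)
qed

lemma zero: "(\<lambda>_. 0) \<in> F"
  using scale[OF laurent, of 0] by simp

lemma one: "(\<lambda>_. 1) \<in> F"
  using laurent[of "Poly_Mapping.single 0 1"] by (simp add: leval_single[abs_def] del: single_one)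

lemma sum_closed:
  assumes "finite I" "\<And>i. i \<in> I \<Longrightarrow> f i \<in> F"
  shows "(\<lambda>z. \<Sum>i\<in>I. c i * f i z) \<in> F"
  using assms by (induction I rule: finite_induct) (simp_all add: zero add scale)

lemma cmv_closed: "cmv k \<in> F"
proof -
  have "cmv k = leval (Poly_Mapping.single (if even k then int (k div 2) else - int (k div 2) - 1) 1)"
    by (simp add: fun_eq_iff leval_single cmv_def)
  then show ?thesis using laurent by metis
qed

lemma cmv_poly_closed: "cmv_poly S k \<in> F"
  unfolding cmv_poly_def[abs_def] by (rule sum_closed) (auto simp: cmv_closed)

lemma ex_cauchy_kernel:
  assumes "closedin (top_of_set (- {0})) S" "w \<noteq> 0" "w \<notin> S"
  shows "\<exists>h\<in>F. agree_near S (\<lambda>z. 1 / (w - z)) h"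
proof -
  \<comment> \<open>The kernel 1/(w - z) is the constant 1 divided by the Laurent polynomial w - z,
    whose only zero w lies outside S.\<close>
  define L where "L = Poly_Mapping.single 0 w + Poly_Mapping.single (1::int) (- 1)"
  have L: "leval L z = w - z" for z
    by (simp add: L_def leval_add leval_single)
  have "\<exists>g\<in>F. agree_near S (\<lambda>z. 1 / leval L z) g"
    by (rule admissible_quotient[OF assms(1) _ one]) (use assms(3) in \<open>auto simp: lzeros_def L\<close>)
  then show ?thesis by (simp add: L)
qed

end


section \<open>Evaluation of bivariate functionals\<close>

lemma agree_near_refl: "agree_near S f f"
  by (auto simp: agree_near_def)

lemma agree_near_mono: "agree_near S f g \<Longrightarrow> T \<subseteq> S \<Longrightarrow> agree_near T f g"
  unfolding agree_near_def by blast

lemma agree_near_off_zero: "(\<And>z. z \<noteq> 0 \<Longrightarrow> f z = g z) \<Longrightarrow> agree_near S f g"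
  unfolding agree_near_def by (rule exI[of _ UNIV]) auto

lemma agree_near_sym: "agree_near S f g \<Longrightarrow> agree_near S g f"
  unfolding agree_near_def by metis

lemma agree_near_comp2:
  assumes "agree_near S f f'" "agree_near S g g'"
  shows "agree_near S (\<lambda>z. P z (f z) (g z)) (\<lambda>z. P z (f' z) (g' z))"
proof -
  obtain W W' where "open W" "S \<subseteq> W" "\<forall>z\<in>W - {0}. f z = f' z"
    "open W'" "S \<subseteq> W'" "\<forall>z\<in>W' - {0}. g z = g' z"
    using assms by (auto simp: agree_near_def)
  then show ?thesis unfolding agree_near_def
    by (intro exI[of _ "W \<inter> W'"]) auto
qed

lemma agree_near_trans:
  assumes "agree_near S f g" "agree_near S g h"
  shows "agree_near S f h"
proof -
  obtain W W' where "open W" "S \<subseteq> W" "\<forall>z\<in>W - {0}. f z = g z"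
    "open W'" "S \<subseteq> W'" "\<forall>z\<in>W' - {0}. g z = h z"
    using assms by (auto simp: agree_near_def)
  then show ?thesis unfolding agree_near_def
    by (intro exI[of _ "W \<inter> W'"]) auto
qed

text \<open>The points of the punctured plane where L does not vanish form an open set by
  continuity, and this set contains S.\<close>

lemma agree_near_cancel_leval:
  assumes "lzeros L \<inter> S = {}" "S \<subseteq> - {0}"
  shows "agree_near S (\<lambda>z. leval L z * f z / leval L z) f"
proof -
  define W where "W = {z. z \<noteq> 0 \<and> leval L z \<noteq> 0}"
  have "open (- {0} \<inter> leval L -` (- {0}))"
    by (rule continuous_open_preimage[OF holomorphic_on_imp_continuous_on[OF holomorphic_on_leval]]) auto
  also have "- {0} \<inter> leval L -` (- {0}) = W" by (auto simp: W_def)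
  finally have "open W" .
  moreover have "S \<subseteq> W" using assms unfolding W_def lzeros_def by blast
  ultimately show ?thesis unfolding agree_near_def by (auto simp: W_def)
qed

lemma supp_nonzero: "supp1 F u \<subseteq> - {0}" "supp2 F u \<subseteq> - {0}"
  by (auto simp: supp1_def supp2_def form_support_def)

locale bivariate_form = fundamental_space F for F +
  fixes u :: form
  assumes bivariate: "bivariate_functional F u"
begin

lemma linear_left:
  "f \<in> F \<Longrightarrow> f' \<in> F \<Longrightarrow> g \<in> F \<Longrightarrow> u (\<lambda>z. f z + f' z) g = u f g + u f' g"
  "f \<in> F \<Longrightarrow> g \<in> F \<Longrightarrow> u (\<lambda>z. c * f z) g = c * u f g"
  using bivariate by (auto simp: bivariate_functional_def sesquilinear_def linear_functional_def)

lemma linear_right: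
  assumes "f \<in> F" "g \<in> F"
  shows "g' \<in> F \<Longrightarrow> u f (\<lambda>z. g z + g' z) = u f g + u f g'"
    "u f (\<lambda>z. c * g z) = cnj c * u f g"
proof -
  have lin: "linear_functional F (\<lambda>g. cnj (u f g))"
    using bivariate assms by (auto simp: bivariate_functional_def sesquilinear_def)
  then have "cnj (u f (\<lambda>z. c * g z)) = cnj (cnj c * u f g)"
    using assms by (auto simp: linear_functional_def)
  then show "u f (\<lambda>z. c * g z) = cnj c * u f g" by (simp only: complex_cnj_cancel_iff)
  assume "g' \<in> F"
  then have "cnj (u f (\<lambda>z. g z + g' z)) = cnj (u f g + u f g')"
    using lin assms by (auto simp: linear_functional_def)
  then show "u f (\<lambda>z. g z + g' z) = u f g + u f g'" by (simp only: complex_cnj_cancel_iff)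
qed

lemma sum_left:
  assumes "finite I" "\<And>i. i \<in> I \<Longrightarrow> f i \<in> F" "g \<in> F"
  shows "u (\<lambda>z. \<Sum>i\<in>I. c i * f i z) g = (\<Sum>i\<in>I. c i * u (f i) g)"
  using assms
proof (induction I rule: finite_induct)
  case empty
  then show ?case using linear_left(2)[OF zero, of g 0] by simp
next
  case (insert i I)
  then show ?case by (simp add: linear_left scale sum_closed)
qed

lemma sum_right:
  assumes "finite I" "\<And>i. i \<in> I \<Longrightarrow> g i \<in> F" "f \<in> F"
  shows "u f (\<lambda>z. \<Sum>i\<in>I. c i * g i z) = (\<Sum>i\<in>I. cnj (c i) * u f (g i))"
  using assms
proof (induction I rule: finite_induct)
  case empty
  then show ?case using linear_right(2)[OF _ zero, of f 0] by simp
next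
  case (insert i I)
  then show ?case by (simp add: linear_right scale sum_closed)
qed

text \<open>One argument is changed at a time: the difference vanishes near the corresponding
  projection of the support, so the form vanishes on it.\<close>

lemma form_cong:
  assumes "f \<in> F" "f' \<in> F" "g \<in> F" "g' \<in> F"
    and "agree_near (supp1 F u) f f'" "agree_near (supp2 F u) g g'"
  shows "u f g = u f' g'"
proof -
  have van: "u p q = 0" if "p \<in> F" "q \<in> F"
    "agree_near (supp1 F u) p (\<lambda>_. 0) \<or> agree_near (supp2 F u) q (\<lambda>_. 0)" for p q
    using bivariate that by (auto simp: bivariate_functional_def)
  have neg: "(\<lambda>z. p z + (- 1) * q z) \<in> F" if "p \<in> F" "q \<in> F" for p q
    using that by (intro add scale)
  have ag: "agree_near S (\<lambda>z. p z + (- 1) * q z) (\<lambda>_. 0)" if "agree_near S p q" for S p q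
    using agree_near_comp2[OF that agree_near_refl[of S q], of "\<lambda>_ a b. a + (- 1) * b"] by simp
  have "u (\<lambda>z. f z + (- 1) * f' z) g = 0"
    by (intro van neg assms disjI1 ag)
  moreover have "u (\<lambda>z. f z + c * f' z) g = u f g + c * u f' g" for c
    using assms by (simp add: linear_left scale)
  ultimately have "u f g + (- 1) * u f' g = 0" by metis
  moreover have "u f' (\<lambda>z. g z + (- 1) * g' z) = 0"
    by (intro van neg assms disjI2 ag)
  moreover have "u f' (\<lambda>z. g z + c * g' z) = u f' g + cnj c * u f' g'" for c
    using assms by (simp add: linear_right scale)
  ultimately have "u f g + (- 1) * u f' g = 0" "u f' g + cnj (- 1) * u f' g' = 0" by metis+
  then show ?thesis by simp
qed

lemma form_cong_off_zero:
  assumes "f \<in> F" "f' \<in> F" "g \<in> F" "g' \<in> F"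
    and "\<And>z. z \<noteq> 0 \<Longrightarrow> f z = f' z" "\<And>z. z \<noteq> 0 \<Longrightarrow> g z = g' z"
  shows "u f g = u f' g'"
  using assms by (intro form_cong agree_near_off_zero)

text \<open>The choice inside \<open>bracket\<close> is undone here: by \<open>form_cong\<close>
  every pair of representatives gives the same value. All brackets below are evaluated by this
  rule.\<close>

lemma bracket_eq:
  assumes "f' \<in> F" "g' \<in> F" "agree_near (supp1 F u) f f'" "agree_near (supp2 F u) g g'"
  shows "bracket F u f g = u f' g'"
proof -
  define p where "p = (SOME f'. f' \<in> F \<and> agree_near (supp1 F u) f f')"
  define q where "q = (SOME g'. g' \<in> F \<and> agree_near (supp2 F u) g g')"
  have p: "p \<in> F \<and> agree_near (supp1 F u) f p"
    unfolding p_def by (rule someI[where x = f']) (simp add: assms)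
  have q: "q \<in> F \<and> agree_near (supp2 F u) g q"
    unfolding q_def by (rule someI[where x = g']) (simp add: assms)
  have "u p q = u f' g'"
    using p q assms by (intro form_cong) (blast intro: agree_near_trans agree_near_sym)+
  then show ?thesis by (simp add: bracket_def p_def q_def)
qed

lemma bracket_closed: "f \<in> F \<Longrightarrow> g \<in> F \<Longrightarrow> bracket F u f g = u f g"
  by (intro bracket_eq agree_near_refl)

lemma gu_form12_leval_mult:
  assumes "lzeros L \<inter> supp1 F u = {}" "zeros_enum L d \<zeta> m" "f \<in> F" "g \<in> F"
  shows "gu_form12 F u L M d \<zeta> m \<xi> (\<lambda>z. leval L z * f z) g = u f (\<lambda>z. leval M z * g z)"
proof -
  \<comment> \<open>The discrete part dies through its derivative factors, whatever the values of
    the functionals \<open>\<xi>\<close>.\<close>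
  have "(dz ^^ k) (\<lambda>z. leval L z * f z) (\<zeta> i) = 0" if "i \<in> {1..d}" "k < m i" for i k
  proof (rule higher_dz_leval_mult_eq_0[OF assms(3)])
    have "\<zeta> i \<in> lzeros L" using assms(2) that(1) unfolding zeros_enum_def by (blast dest: bij_betwE)
    then show "\<zeta> i \<noteq> 0" by (simp add: lzeros_def)
    show "k < lmult L (\<zeta> i)" using assms(2) that by (simp add: zeros_enum_def)
  qed
  moreover have "bracket F u (\<lambda>z. leval L z * f z / leval L z) (\<lambda>z. leval M z * g z) =
      u f (\<lambda>z. leval M z * g z)"
    by (intro bracket_eq laurent_mult assms agree_near_refl agree_near_cancel_leval supp_nonzero)
  ultimately show ?thesis by (simp add: gu_form12_def)
qed

end


section \<open>Boundary terms of banded sums\<close>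

lemma sum_window:
  fixes f :: "nat \<Rightarrow> 'a::comm_monoid_add"
  assumes "p \<le> l" "\<And>k. k < l - p \<Longrightarrow> f k = 0"
  shows "(\<Sum>k<l. f k) = (\<Sum>i<p. f (l - p + i))"
proof -
  have "(\<Sum>k<l. f k) = (\<Sum>k\<in>{l - p..<l}. f k)"
    using assms(2) by (intro sum.mono_neutral_right) auto
  also have "\<dots> = (\<Sum>i<p. f (l - p + i))"
    using assms(1) sum.shift_bounds_nat_ivl[of f 0 "l - p" p]
    by (simp add: atLeast0LessThan add.commute)
  finally show ?thesis .
qed

lemma sum_window_above:
  fixes f :: "nat \<Rightarrow> 'a::comm_monoid_add"
  assumes "l + p \<le> m" "\<And>k. l + p \<le> k \<Longrightarrow> f k = 0"
  shows "(\<Sum>k\<in>{l..<m}. f k) = (\<Sum>i<p. f (l + i))"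
proof -
  have "(\<Sum>k\<in>{l..<m}. f k) = (\<Sum>k\<in>{l..<l + p}. f k)"
    using assms by (intro sum.mono_neutral_right) auto
  also have "\<dots> = (\<Sum>i<p. f (l + i))"
    using sum.shift_bounds_nat_ivl[of f 0 l p]
    by (simp add: atLeast0LessThan add.commute)
  finally show ?thesis .
qed

text \<open>Only the two off-diagonal blocks contribute. Indices such as
  \<open>l - 2 * N\<Gamma> + (2 * N\<Gamma> + j)\<close> stay as they are, since natural subtraction
  collapses them only when \<open>l\<close> is large enough.\<close>

lemma window_product_conn_block12:
  "window_product N\<Gamma> NC l a (conn_block12 \<Omega> N\<Gamma> NC l) b =
    (\<Sum>i<2 * NC. \<Sum>j<2 * NC. a (l - 2 * NC + i) * cnj (\<Omega> (l - 2 * NC + i) (l + j)) * b (l - 2 * N\<Gamma> + (2 * N\<Gamma> + j)))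
    - (\<Sum>i<2 * N\<Gamma>. \<Sum>j<2 * N\<Gamma>. a (l - 2 * NC + (2 * NC + i)) * cnj (\<Omega> (l + i) (l - 2 * N\<Gamma> + j)) * b (l - 2 * N\<Gamma> + j))"
proof -
  define M where "M = conn_block12 \<Omega> N\<Gamma> NC l"
  have dim: "dim_row M = 2 * NC + 2 * N\<Gamma>" "dim_col M = 2 * N\<Gamma> + 2 * NC"
    by (simp_all add: M_def conn_block12_def conn_C_def conn_Gamma_def)
  have split: "(\<Sum>i<p + q. f i) = (\<Sum>i<p. f i) + (\<Sum>i<q. f (p + i))" for f :: "nat \<Rightarrow> complex" and p q
    by (induction q) (simp_all add: add.assoc)
  have M: "i < 2 * NC \<Longrightarrow> j < 2 * N\<Gamma> \<Longrightarrow> M $$ (i, j) = 0"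
    "i < 2 * NC \<Longrightarrow> j < 2 * NC \<Longrightarrow> M $$ (i, 2 * N\<Gamma> + j) = cnj (\<Omega> (l - 2 * NC + i) (l + j))"
    "i < 2 * N\<Gamma> \<Longrightarrow> j < 2 * N\<Gamma> \<Longrightarrow> M $$ (2 * NC + i, j) = - cnj (\<Omega> (l + i) (l - 2 * N\<Gamma> + j))"
    "i < 2 * N\<Gamma> \<Longrightarrow> j < 2 * NC \<Longrightarrow> M $$ (2 * NC + i, 2 * N\<Gamma> + j) = 0" for i j
    by (simp_all add: M_def conn_block12_def conn_C_def conn_Gamma_def)
  have "window_product N\<Gamma> NC l a M b =
      (\<Sum>i<2 * NC + 2 * N\<Gamma>. a (l - 2 * NC + i) *
        (\<Sum>j<2 * N\<Gamma> + 2 * NC. M $$ (i, j) * b (l - 2 * N\<Gamma> + j)))"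
    by (simp add: window_product_def scalar_prod_def atLeast0LessThan dim)
  then show ?thesis
    by (simp add: split M M_def[symmetric] sum_distrib_left sum_negf mult.assoc)
qed

text \<open>Both double sums contain the square k, q < l, which cancels. What remains of the first
  has k < l <= q, the block of \<open>conn_C\<close>; what remains of the second has q < l <= k, the
  block of \<open>conn_Gamma\<close>.\<close>

lemma banded_window_product:
  assumes up: "\<And>k q. k + 2 * NC < q \<Longrightarrow> \<Omega> k q = 0"
    and low: "\<And>k q. q + 2 * N\<Gamma> < k \<Longrightarrow> \<Omega> k q = 0"
    and l: "2 * NC \<le> l" "2 * N\<Gamma> \<le> l"
  shows "(\<Sum>k<l. a k * (\<Sum>q\<le>k + 2 * NC. cnj (\<Omega> k q) * b q))
      - (\<Sum>q<l. (\<Sum>k\<le>q + 2 * N\<Gamma>. a k * cnj (\<Omega> k q)) * b q)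
    = window_product N\<Gamma> NC l a (conn_block12 \<Omega> N\<Gamma> NC l) b"
proof -
  define w where "w k q = a k * cnj (\<Omega> k q) * b q" for k q
  \<comment> \<open>A common cut-off: whenever one index of a nonzero entry is below l, the band
    keeps the other below m.\<close>
  define m where "m = l + 2 * NC + 2 * N\<Gamma>"
  have split: "(\<Sum>k<m. f k) = (\<Sum>k<l. f k) + (\<Sum>k\<in>{l..<m}. f k)" for f :: "nat \<Rightarrow> complex"
    using sum.atLeastLessThan_concat[of 0 l m f] by (simp add: m_def atLeast0LessThan)
  have "(\<Sum>k<l. a k * (\<Sum>q\<le>k + 2 * NC. cnj (\<Omega> k q) * b q)) = (\<Sum>k<l. \<Sum>q<m. w k q)"
    unfolding sum_distrib_left w_def
    by (intro sum.cong refl sum.mono_neutral_cong_left) (auto simp: m_def up mult.assoc)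
  also have "\<dots> = (\<Sum>k<l. \<Sum>q<l. w k q) + (\<Sum>k<l. \<Sum>q\<in>{l..<m}. w k q)"
    by (simp only: split sum.distrib)
  \<comment> \<open>A row k < l - 2NC ends before column l, so only the last 2NC rows reach beyond
    it.\<close>
  also have "(\<Sum>k<l. \<Sum>q\<in>{l..<m}. w k q) = (\<Sum>i<2 * NC. \<Sum>q\<in>{l..<m}. w (l - 2 * NC + i) q)"
    by (intro sum_window l sum.neutral) (auto simp: w_def up)
  also have "\<dots> = (\<Sum>i<2 * NC. \<Sum>j<2 * NC. w (l - 2 * NC + i) (l + j))"
    using l by (intro sum.cong refl sum_window_above) (auto simp: w_def m_def up)
  finally have upper: "(\<Sum>k<l. a k * (\<Sum>q\<le>k + 2 * NC. cnj (\<Omega> k q) * b q)) =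
      (\<Sum>k<l. \<Sum>q<l. w k q) + (\<Sum>i<2 * NC. \<Sum>j<2 * NC. w (l - 2 * NC + i) (l + j))" .
  have "(\<Sum>q<l. (\<Sum>k\<le>q + 2 * N\<Gamma>. a k * cnj (\<Omega> k q)) * b q) = (\<Sum>q<l. \<Sum>k<m. w k q)"
    unfolding sum_distrib_right w_def
    by (intro sum.cong refl sum.mono_neutral_cong_left) (auto simp: m_def low mult.assoc)
  also have "\<dots> = (\<Sum>q<l. \<Sum>k<l. w k q) + (\<Sum>q<l. \<Sum>k\<in>{l..<m}. w k q)"
    by (simp only: split sum.distrib)
  also have "(\<Sum>q<l. \<Sum>k<l. w k q) = (\<Sum>k<l. \<Sum>q<l. w k q)"
    by (rule sum.swap)
  also have "(\<Sum>q<l. \<Sum>k\<in>{l..<m}. w k q) = (\<Sum>j<2 * N\<Gamma>. \<Sum>k\<in>{l..<m}. w k (l - 2 * N\<Gamma> + j))"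
    by (intro sum_window l sum.neutral) (auto simp: w_def low)
  also have "\<dots> = (\<Sum>j<2 * N\<Gamma>. \<Sum>i<2 * N\<Gamma>. w (l + i) (l - 2 * N\<Gamma> + j))"
    using l by (intro sum.cong refl sum_window_above) (auto simp: w_def m_def low)
  also have "\<dots> = (\<Sum>i<2 * N\<Gamma>. \<Sum>j<2 * N\<Gamma>. w (l + i) (l - 2 * N\<Gamma> + j))"
    by (rule sum.swap)
  finally show ?thesis
    unfolding upper window_product_conn_block12 w_def using l by simp
qed


section \<open>Biorthogonality\<close>

locale biorthogonal_form = bivariate_form F u for F u +
  fixes S1 S2 :: smat and H :: "nat \<Rightarrow> complex"
  assumes gauss_borel: "gauss_borel (gram F u) S1 H S2"
begin

lemma unitriangular: "lower_unitriangular S1" "lower_unitriangular S2"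
  and H_nonzero: "H k \<noteq> 0"
  using gauss_borel by (auto simp: gauss_borel_def)

abbreviation "\<phi>1 \<equiv> cmv_poly S1"
abbreviation "\<phi>2 \<equiv> cmv_poly S2"

text \<open>The factorization says S1 G = H times the adjoint of the inverse of S2. Adjoints of
  lower triangular matrices have infinite rows, so the contraction with S2 is carried out on entries
  instead of by associativity.\<close>

lemma biorthogonal: "u (\<phi>1 k) (\<phi>2 l) = (if k = l then H k else 0)"
proof -
  let ?G = "gram F u"
  note lub = lower_unitriangular_banded
  note S1 = lub[OF unitriangular(1)] and S2 = lub[OF unitriangular(2)]
    and I1 = lub[OF sm_inv(1)[OF unitriangular(1)]]
  have G: "u (cmv i) (cmv j) = ?G i j" for i j
    by (simp add: gram_def bracket_closed cmv_closed)
  have "?G = sm_mult (sm_mult (sm_inv S1) (sm_diag H)) (sm_adjoint (sm_inv S2))"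
    using gauss_borel by (simp add: gauss_borel_def)
  then have "sm_mult S1 ?G = sm_mult (sm_diag H) (sm_adjoint (sm_inv S2))"
    by (simp add: sm_mult_assoc[OF I1 banded_sm_diag] sm_mult_assoc[OF S1 I1, symmetric]
        sm_inv(2)[OF unitriangular(1)])
  then have SG: "sm_mult S1 ?G k j = H k * cnj (sm_inv S2 j k)" for j
    by (simp add: sm_mult_diag_left sm_adjoint_def)
  have left: "u (\<phi>1 k) (cmv j) = H k * cnj (sm_inv S2 j k)" for j
    unfolding cmv_poly_def[abs_def]
    by (simp add: sum_left cmv_closed G SG[symmetric] sm_mult_eq_sum[OF S1, of k k])
  have "u (\<phi>1 k) (\<phi>2 l) = (\<Sum>j\<le>l. cnj (S2 l j) * (H k * cnj (sm_inv S2 j k)))"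
    unfolding cmv_poly_def[of S2, abs_def]
    by (simp add: sum_right cmv_closed cmv_poly_closed left)
  also have "\<dots> = H k * cnj (sm_mult S2 (sm_inv S2) l k)"
    by (simp add: sm_mult_eq_sum[OF S2, of l l] sum_distrib_left mult.left_commute)
  finally show ?thesis
    by (auto simp: sm_inv(2)[OF unitriangular(2)] sm_one_def)
qed

text \<open>The triangular inverse of S1 rewrites f in \<open>\<phi>1\<close> without increasing the
  length n. Pairing with \<open>\<phi>2\<close> then reads off the coefficients, and gives 0 beyond
  n.\<close>

lemma biorthogonal_expansion:
  assumes "f \<in> F" and f: "\<And>z. z \<noteq> 0 \<Longrightarrow> f z = (\<Sum>j<n. c j * cmv j z)"
  shows "z \<noteq> 0 \<Longrightarrow> f z = (\<Sum>k<n. u f (\<phi>2 k) / H k * \<phi>1 k z)"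
    and "n \<le> k \<Longrightarrow> u f (\<phi>2 k) = 0"
proof -
  define d where "d k = (\<Sum>j<n. c j * sm_inv S1 j k)" for k
  have inv0: "sm_inv S1 j k = 0" if "j < k" for j k
    using sm_inv(1)[OF unitriangular(1)] that by (simp add: lower_unitriangular_def)
  have cmv: "cmv j z = (\<Sum>k<n. sm_inv S1 j k * \<phi>1 k z)" if "j < n" for j z
    unfolding cmv_eq_sum_cmv_poly[OF unitriangular(1), of j z]
    using that by (intro sum.mono_neutral_left) (auto simp: inv0)
  have fd: "f z = (\<Sum>k<n. d k * \<phi>1 k z)" if "z \<noteq> 0" for z
  proof -
    have "f z = (\<Sum>j<n. c j * (\<Sum>k<n. sm_inv S1 j k * \<phi>1 k z))"
      by (simp add: f[OF that] cmv)
    also have "\<dots> = (\<Sum>k<n. d k * \<phi>1 k z)"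
      by (simp add: d_def sum_distrib_left sum_distrib_right mult.assoc) (rule sum.swap)
    finally show ?thesis .
  qed
  have "u f (\<phi>2 k) = u (\<lambda>z. \<Sum>j<n. d j * \<phi>1 j z) (\<phi>2 k)" for k
    using assms(1) fd by (intro form_cong_off_zero sum_closed) (auto simp: cmv_poly_closed)
  then have u: "u f (\<phi>2 k) = (\<Sum>j<n. d j * (if j = k then H j else 0))" for k
    by (simp add: sum_left cmv_poly_closed biorthogonal)
  then have "u f (\<phi>2 k) = d k * H k" if "k < n" for k
    using that by (simp add: if_distrib[of "\<lambda>x. _ * x"] cong: if_cong)
  then show "f z = (\<Sum>k<n. u f (\<phi>2 k) / H k * \<phi>1 k z)" if "z \<noteq> 0"
    by (simp add: fd[OF that] H_nonzero)
  show "u f (\<phi>2 k) = 0" if "n \<le> k"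
    using that by (simp add: u)
qed

end


section \<open>Forms intertwined by Laurent polynomials\<close>

text \<open>The intertwining identity is all that is kept of the perturbation, so the same lemmas
  serve both \<open>u12\<close> and the adjoint of \<open>u21\<close>.\<close>

locale intertwined_forms = U: biorthogonal_form F u S1 S2 H + V: biorthogonal_form F v T1 T2 K
  for F u S1 S2 H v T1 T2 K +
  fixes L M :: laurent and N\<Gamma> NC :: nat
  assumes intertwining:
      "f \<in> F \<Longrightarrow> g \<in> F \<Longrightarrow> v (\<lambda>z. leval L z * f z) g = u f (\<lambda>z. leval M z * g z)"
    and L_bound: "laurent_bound L N\<Gamma>"
    and M_bound: "laurent_bound M NC"
begin

abbreviation "\<Omega> \<equiv> connector T2 M S2"

lemma form_M_right:
  assumes "f \<in> F"
  shows "u f (\<lambda>z. leval M z * V.\<phi>2 k z) = (\<Sum>q\<le>k + 2 * NC. cnj (\<Omega> k q) * u f (U.\<phi>2 q))"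
proof -
  have "u f (\<lambda>z. leval M z * V.\<phi>2 k z) = u f (\<lambda>z. \<Sum>q\<le>k + 2 * NC. \<Omega> k q * U.\<phi>2 q z)"
    using assms leval_mult_cmv_poly_connector[OF M_bound V.unitriangular(2) U.unitriangular(2)]
    by (intro U.form_cong_off_zero U.sum_closed U.laurent_mult U.cmv_poly_closed) auto
  then show ?thesis
    by (simp add: U.sum_right U.cmv_poly_closed assms)
qed

lemma \<Omega>_upper: "k + 2 * NC < q \<Longrightarrow> \<Omega> k q = 0"
  using banded_connector[OF M_bound V.unitriangular(2) U.unitriangular(2)]
  by (rule bandedD)

lemma form_L_left: "v (\<lambda>z. leval L z * U.\<phi>1 q z) (V.\<phi>2 k) = cnj (\<Omega> k q) * H q"
proof -
  have "v (\<lambda>z. leval L z * U.\<phi>1 q z) (V.\<phi>2 k) =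
      (\<Sum>p\<le>k + 2 * NC. cnj (\<Omega> k p) * (if q = p then H q else 0))"
    by (simp add: intertwining U.cmv_poly_closed form_M_right U.biorthogonal)
  \<comment> \<open>If q lies beyond the summation range, the sum is 0, and so is the entry of the
    connector by \<open>\<Omega>_upper\<close>.\<close>
  also have "\<dots> = cnj (\<Omega> k q) * H q"
    using \<Omega>_upper[of k q] by (auto simp: if_distrib[of "\<lambda>x. _ * x"] cong: if_cong)
  finally show ?thesis .
qed

lemma leval_mult_phi1_closed: "(\<lambda>z. leval L z * U.\<phi>1 q z) \<in> F"
  by (intro U.laurent_mult U.cmv_poly_closed)

lemma leval_mult_phi1_cmv:
  assumes "z \<noteq> 0"
  shows "leval L z * U.\<phi>1 q z =
    (\<Sum>j<Suc (q + 2 * N\<Gamma>). sm_mult S1 (laurent_upsilon L) q j * cmv j z)"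
  unfolding lessThan_Suc_atMost by (rule leval_mult_cmv_poly[OF L_bound U.unitriangular(1) assms])

text \<open>By \<open>form_L_left\<close> an entry is, up to conjugation and the nonzero factor H q,
  the pairing of L \<open>\<phi>1\<close> q with the perturbed \<open>\<phi>2\<close> k. The degree
  count for L \<open>\<phi>1\<close> q makes it vanish for large k.\<close>

lemma \<Omega>_lower: "q + 2 * N\<Gamma> < k \<Longrightarrow> \<Omega> k q = 0"
  using V.biorthogonal_expansion(2)[OF leval_mult_phi1_closed leval_mult_phi1_cmv, of q k] U.H_nonzero[of q]
  by (simp add: form_L_left)

lemma leval_mult_phi1:
  assumes "z \<noteq> 0"
  shows "leval L z * U.\<phi>1 q z = (\<Sum>k\<le>q + 2 * N\<Gamma>. (cnj (\<Omega> k q) * H q / K k) * V.\<phi>1 k z)"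
  using V.biorthogonal_expansion(1)[OF leval_mult_phi1_closed leval_mult_phi1_cmv assms, of q]
  by (simp add: form_L_left lessThan_Suc_atMost)

text \<open>The expansion of L \<open>\<phi>1\<close> q is paired with an arbitrary test function,
  so that a representative of the Cauchy kernel can be inserted.\<close>

lemma form_M_phi1:
  assumes "h \<in> F"
  shows "u (U.\<phi>1 q) (\<lambda>z. leval M z * h z) =
    (\<Sum>k\<le>q + 2 * N\<Gamma>. (cnj (\<Omega> k q) * H q / K k) * v (V.\<phi>1 k) h)"
proof -
  have "u (U.\<phi>1 q) (\<lambda>z. leval M z * h z) = v (\<lambda>z. leval L z * U.\<phi>1 q z) h"
    by (simp add: intertwining U.cmv_poly_closed assms)
  also have "\<dots> = v (\<lambda>z. \<Sum>k\<le>q + 2 * N\<Gamma>. (cnj (\<Omega> k q) * H q / K k) * V.\<phi>1 k z) h"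
    using assms leval_mult_phi1
    by (intro V.form_cong_off_zero U.sum_closed leval_mult_phi1_closed U.cmv_poly_closed) auto
  also have "\<dots> = (\<Sum>k\<le>q + 2 * N\<Gamma>. (cnj (\<Omega> k q) * H q / K k) * v (V.\<phi>1 k) h)"
    by (intro V.sum_left U.cmv_poly_closed assms) simp
  finally show ?thesis .
qed

section \<open>The two mixed kernel formulas for intertwined forms\<close>

lemma mixed_kernel_second_kind2:
  assumes l: "2 * NC \<le> l" "2 * N\<Gamma> \<le> l" and x: "x1 \<noteq> 0" "x2 \<noteq> 0"
    and supp: "cnj x1 \<notin> supp1 F u \<union> supp1 F v"
  shows "leval L (cnj x1) * cd_kernel K (second_kind2 F v V.\<phi>2) V.\<phi>1 l x1 x2
      - leval L x2 * cd_kernel H (second_kind2 F u U.\<phi>2) U.\<phi>1 l x1 x2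
      - diff_quot (leval L) (cnj x1) x2
    = window_product N\<Gamma> NC l (\<lambda>k. V.\<phi>1 k x2 / K k) (conn_block12 \<Omega> N\<Gamma> NC l)
        (\<lambda>k. cnj (second_kind2 F u U.\<phi>2 k x1))"
proof -
  define w where "w = cnj x1"
  have w: "w \<noteq> 0" using x by (simp add: w_def)
  have "closedin (top_of_set (- {0})) (supp1 F u \<union> supp1 F v)"
    using U.bivariate V.bivariate by (auto simp: bivariate_functional_def)
  \<comment> \<open>One representative of the Cauchy kernel near both supports, so that intertwining
    can be applied to the same function in both forms.\<close>
  then obtain h where h: "h \<in> F" "agree_near (supp1 F u \<union> supp1 F v) (\<lambda>z. 1 / (w - z)) h"
    using U.ex_cauchy_kernel[OF _ w] supp by (auto simp: w_def)
  have hu: "agree_near (supp1 F u) (\<lambda>z. 1 / (w - z)) h"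
    and hv: "agree_near (supp1 F v) (\<lambda>z. 1 / (w - z)) h"
    using h(2) by (auto elim: agree_near_mono)
  have Cu: "cnj (second_kind2 F u U.\<phi>2 k x1) = u h (U.\<phi>2 k)" for k
    using U.bracket_eq[OF h(1) U.cmv_poly_closed hu agree_near_refl]
    by (simp add: second_kind2_def w_def)
  have Cv: "cnj (second_kind2 F v V.\<phi>2 k x1) = v h (V.\<phi>2 k)" for k
    using V.bracket_eq[OF h(1) U.cmv_poly_closed hv agree_near_refl]
    by (simp add: second_kind2_def w_def)
  obtain c where c: "\<And>z. z \<noteq> 0 \<Longrightarrow> (w - z) * (\<Sum>j<2 * N\<Gamma>. c j * cmv j z) = leval L w - leval L z"
    using leval_diff_cmv[OF L_bound w] by blast
  define D where "D z = (\<Sum>j<2 * N\<Gamma>. c j * cmv j z)" for z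
  have D: "D \<in> F"
    unfolding D_def[abs_def] by (intro U.sum_closed U.cmv_closed) simp
  have diff_quot: "diff_quot (leval L) w x2 = D x2"
    by (rule diff_quot_unique[where S = "- {0}"])
       (use w x c in \<open>auto simp: D_def[abs_def] holomorphic_on_leval continuous_on_cmv
          intro!: continuous_intros\<close>)
  \<comment> \<open>Near the support L(w) h = D + L h. The intertwining identity turns the second
    summand into a value of the unperturbed form.\<close>
  have split: "leval L w * v h g = v D g + u h (\<lambda>z. leval M z * g z)" if g: "g \<in> F" for g
  proof -
    have Lh: "(\<lambda>z. leval L z * h z) \<in> F" by (rule U.laurent_mult[OF h(1)])
    obtain W where W: "open W" "supp1 F v \<subseteq> W" "\<And>z. z \<in> W \<Longrightarrow> z \<noteq> 0 \<Longrightarrow> 1 / (w - z) = h z"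
      using hv by (auto simp: agree_near_def)
    have "agree_near (supp1 F v) (\<lambda>z. leval L w * h z) (\<lambda>z. D z + leval L z * h z)"
      unfolding agree_near_def
    \<comment> \<open>The point w is removed because 1 / (w - w) is 0 by convention and the
      pointwise identity may fail there; w lies outside the support anyway.\<close>
    proof (intro exI[of _ "W - {w}"] conjI ballI)
      show "open (W - {w})" using W(1) by (rule open_delete)
      show "supp1 F v \<subseteq> W - {w}" using W(2) supp by (auto simp: w_def)
      fix z assume z: "z \<in> W - {w} - {0}"
      then have "h z = 1 / (w - z)" using W(3) by simp
      moreover have "D z = (leval L w - leval L z) / (w - z)"
        using c[of z] z by (auto simp: D_def eq_divide_eq mult.commute)
      ultimately show "leval L w * h z = D z + leval L z * h z"
        by (simp add: diff_divide_distrib)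
    qed
    then have "v (\<lambda>z. leval L w * h z) g = v (\<lambda>z. D z + leval L z * h z) g"
      by (intro V.form_cong agree_near_refl U.scale U.add D Lh h(1) g)
    then show ?thesis
      by (simp add: V.linear_left h(1) g D Lh intertwining)
  qed
  \<comment> \<open>D has fewer than 2N\<Gamma> + 1 CMV terms and 2N\<Gamma> is at most l, so the
    first l perturbed polynomials reproduce it; D x2 is the extra difference quotient.\<close>
  have D_zero: "v D (V.\<phi>2 k) = 0" if "2 * N\<Gamma> \<le> k" for k
    by (rule V.biorthogonal_expansion(2)[OF D D_def that])
  have "D x2 = (\<Sum>k<2 * N\<Gamma>. v D (V.\<phi>2 k) / K k * V.\<phi>1 k x2)"
    by (rule V.biorthogonal_expansion(1)[OF D D_def x(2)])
  also have "\<dots> = (\<Sum>k<l. v D (V.\<phi>2 k) / K k * V.\<phi>1 k x2)"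
    using l(2) by (intro sum.mono_neutral_left) (auto simp: D_zero)
  finally have Dx: "D x2 = (\<Sum>k<l. v D (V.\<phi>2 k) / K k * V.\<phi>1 k x2)" .
  define a where "a k = V.\<phi>1 k x2 / K k" for k
  define b where "b q = u h (U.\<phi>2 q)" for q
  have "leval L w * cd_kernel K (second_kind2 F v V.\<phi>2) V.\<phi>1 l x1 x2 =
      (\<Sum>k<l. (leval L w * v h (V.\<phi>2 k)) * a k)"
    unfolding cd_kernel_def Cv sum_distrib_left
    by (intro sum.cong refl) (simp add: a_def field_simps)
  also have "\<dots> = D x2 + (\<Sum>k<l. a k * (\<Sum>q\<le>k + 2 * NC. cnj (\<Omega> k q) * b q))"
    unfolding Dx sum.distrib[symmetric]
    by (intro sum.cong refl)
       (simp add: split U.cmv_poly_closed form_M_right h(1) a_def b_def distrib_left distrib_right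
         add_divide_distrib mult.commute)
  finally have left: "leval L w * cd_kernel K (second_kind2 F v V.\<phi>2) V.\<phi>1 l x1 x2 =
      D x2 + (\<Sum>k<l. a k * (\<Sum>q\<le>k + 2 * NC. cnj (\<Omega> k q) * b q))" .
  have "leval L x2 * cd_kernel H (second_kind2 F u U.\<phi>2) U.\<phi>1 l x1 x2 =
      (\<Sum>q<l. (leval L x2 * U.\<phi>1 q x2) * (inverse (H q) * b q))"
    unfolding cd_kernel_def Cu sum_distrib_left b_def by (intro sum.cong refl) (simp add: mult_ac)
  \<comment> \<open>The factor H q from the expansion of L \<open>\<phi>1\<close> q cancels the
    inverse norm in the unperturbed kernel.\<close>
  also have "\<dots> = (\<Sum>q<l. (\<Sum>k\<le>q + 2 * N\<Gamma>. a k * cnj (\<Omega> k q)) * b q)"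
    unfolding leval_mult_phi1[OF x(2)] sum_distrib_right
    by (intro sum.cong refl) (simp add: a_def U.H_nonzero)
  finally have right: "leval L x2 * cd_kernel H (second_kind2 F u U.\<phi>2) U.\<phi>1 l x1 x2 =
      (\<Sum>q<l. (\<Sum>k\<le>q + 2 * N\<Gamma>. a k * cnj (\<Omega> k q)) * b q)" .
  have "(\<Sum>k<l. a k * (\<Sum>q\<le>k + 2 * NC. cnj (\<Omega> k q) * b q))
      - (\<Sum>q<l. (\<Sum>k\<le>q + 2 * N\<Gamma>. a k * cnj (\<Omega> k q)) * b q)
    = window_product N\<Gamma> NC l a (conn_block12 \<Omega> N\<Gamma> NC l) b"
    by (rule banded_window_product[OF \<Omega>_upper \<Omega>_lower l])
  then show ?thesis
    using left right diff_quot by (simp add: a_def[abs_def] b_def[abs_def] Cu w_def)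
qed

text \<open>M stays under the bracket together with the Cauchy kernel, so no difference quotient
  splits off. The connector expands the perturbed kernel in \<open>x1\<close>, and
  \<open>form_M_phi1\<close> expands the bracket.\<close>

lemma mixed_kernel_second_kind1:
  assumes l: "2 * NC \<le> l" "2 * N\<Gamma> \<le> l" and x: "x1 \<noteq> 0" "x2 \<noteq> 0"
    and supp: "cnj x2 \<notin> supp2 F u \<union> supp2 F v"
  shows "cnj (leval M x1) * cd_kernel K V.\<phi>2 (second_kind1 F v V.\<phi>1) l x1 x2
      - bracket F u (\<lambda>z1. cd_kernel H U.\<phi>2 U.\<phi>1 l x1 z1) (\<lambda>z2. leval M z2 / (cnj x2 - z2))
    = window_product N\<Gamma> NC l (\<lambda>k. second_kind1 F v V.\<phi>1 k x2 / K k) (conn_block12 \<Omega> N\<Gamma> NC l)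
        (\<lambda>k. cnj (U.\<phi>2 k x1))"
proof -
  define w where "w = cnj x2"
  have w: "w \<noteq> 0" using x by (simp add: w_def)
  have "closedin (top_of_set (- {0})) (supp2 F u \<union> supp2 F v)"
    using U.bivariate V.bivariate by (auto simp: bivariate_functional_def)
  then obtain h where h: "h \<in> F" "agree_near (supp2 F u \<union> supp2 F v) (\<lambda>z. 1 / (w - z)) h"
    using U.ex_cauchy_kernel[OF _ w] supp by (auto simp: w_def)
  have hu: "agree_near (supp2 F u) (\<lambda>z. 1 / (w - z)) h"
    and hv: "agree_near (supp2 F v) (\<lambda>z. 1 / (w - z)) h"
    using h(2) by (auto elim: agree_near_mono)
  have Cv: "second_kind1 F v V.\<phi>1 k x2 = v (V.\<phi>1 k) h" for k
    using V.bracket_eq[OF U.cmv_poly_closed h(1) agree_near_refl hv]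
    by (simp add: second_kind1_def w_def)
  define a where "a k = v (V.\<phi>1 k) h / K k" for k
  define b where "b q = cnj (U.\<phi>2 q x1)" for q
  have "cnj (leval M x1) * cd_kernel K V.\<phi>2 (second_kind1 F v V.\<phi>1) l x1 x2 =
      (\<Sum>k<l. a k * cnj (leval M x1 * V.\<phi>2 k x1))"
    unfolding cd_kernel_def Cv sum_distrib_left
    by (intro sum.cong refl) (simp add: a_def field_simps)
  also have "\<dots> = (\<Sum>k<l. a k * (\<Sum>q\<le>k + 2 * NC. cnj (\<Omega> k q) * b q))"
    by (simp only: leval_mult_cmv_poly_connector[OF M_bound V.unitriangular(2) U.unitriangular(2) x(1)]
        cnj_sum complex_cnj_mult b_def)
  finally have left: "cnj (leval M x1) * cd_kernel K V.\<phi>2 (second_kind1 F v V.\<phi>1) l x1 x2 =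
      (\<Sum>k<l. a k * (\<Sum>q\<le>k + 2 * NC. cnj (\<Omega> k q) * b q))" .
  \<comment> \<open>As a function of z1 the kernel is a finite combination of the
    \<open>\<phi>1\<close> q, so the bracket reduces to pairings of these with M h.\<close>
  have kernel: "(\<lambda>z1. cd_kernel H U.\<phi>2 U.\<phi>1 l x1 z1) = (\<lambda>z. \<Sum>q<l. (b q * inverse (H q)) * U.\<phi>1 q z)"
    by (simp add: cd_kernel_def b_def)
  have Mh: "agree_near (supp2 F u) (\<lambda>z2. leval M z2 / (w - z2)) (\<lambda>z. leval M z * h z)"
    using agree_near_comp2[OF hu agree_near_refl[of _ "\<lambda>_. 0"], of "\<lambda>z a b. leval M z * a"] by simp
  have "bracket F u (\<lambda>z1. cd_kernel H U.\<phi>2 U.\<phi>1 l x1 z1) (\<lambda>z2. leval M z2 / (w - z2)) =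
      u (\<lambda>z. \<Sum>q<l. (b q * inverse (H q)) * U.\<phi>1 q z) (\<lambda>z. leval M z * h z)"
    unfolding kernel
    by (intro U.bracket_eq U.sum_closed U.laurent_mult h(1) Mh agree_near_refl U.cmv_poly_closed) simp
  also have "\<dots> = (\<Sum>q<l. (b q * inverse (H q)) * u (U.\<phi>1 q) (\<lambda>z. leval M z * h z))"
    by (intro U.sum_left U.laurent_mult h(1) U.cmv_poly_closed) simp
  also have "\<dots> = (\<Sum>q<l. (\<Sum>k\<le>q + 2 * N\<Gamma>. a k * cnj (\<Omega> k q)) * b q)"
    unfolding form_M_phi1[OF h(1)] sum_distrib_right sum_distrib_left
    by (intro sum.cong refl) (simp add: a_def U.H_nonzero)
  finally have right: "bracket F u (\<lambda>z1. cd_kernel H U.\<phi>2 U.\<phi>1 l x1 z1) (\<lambda>z2. leval M z2 / (w - z2)) =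
      (\<Sum>q<l. (\<Sum>k\<le>q + 2 * N\<Gamma>. a k * cnj (\<Omega> k q)) * b q)" .
  have "(\<Sum>k<l. a k * (\<Sum>q\<le>k + 2 * NC. cnj (\<Omega> k q) * b q))
      - (\<Sum>q<l. (\<Sum>k\<le>q + 2 * N\<Gamma>. a k * cnj (\<Omega> k q)) * b q)
    = window_product N\<Gamma> NC l a (conn_block12 \<Omega> N\<Gamma> NC l) b"
    by (rule banded_window_product[OF \<Omega>_upper \<Omega>_lower l])
  then show ?thesis
    using left right by (simp add: a_def[abs_def] b_def[abs_def] Cv w_def)
qed

end

lemma intertwined_forms_gu_form12:
  assumes "fundamental_space F" "bivariate_functional F u" "gauss_borel (gram F u) S1 H S2"
    and "bivariate_functional F (gu_form12 F u L M d \<zeta> m \<xi>)"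
    and "gauss_borel (gram F (gu_form12 F u L M d \<zeta> m \<xi>)) T1 K T2"
    and "lzeros L \<inter> supp1 F u = {}" "zeros_enum L d \<zeta> m"
    and "laurent_bound L N\<Gamma>" "laurent_bound M NC"
  shows "intertwined_forms F u S1 S2 H (gu_form12 F u L M d \<zeta> m \<xi>) T1 T2 K L M N\<Gamma> NC"
proof -
  interpret fundamental_space F by fact
  interpret bivariate_form F u by unfold_locales fact
  show ?thesis
    by unfold_locales (use assms in \<open>auto intro: gu_form12_leval_mult\<close>)
qed


section \<open>The adjoint form\<close>

definition adjoint_form :: "form \<Rightarrow> form" where
  "adjoint_form u = (\<lambda>f g. cnj (u g f))"

lemma form_support_adjoint: "form_support F (adjoint_form u) = prod.swap ` form_support F u"
  unfolding form_support_def adjoint_form_def by (auto simp: image_iff) metis+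

lemma supp_adjoint: "supp1 F (adjoint_form u) = supp2 F u" "supp2 F (adjoint_form u) = supp1 F u"
  by (auto simp: supp1_def supp2_def form_support_adjoint image_image)

lemma bracket_adjoint: "bracket F (adjoint_form u) f g = cnj (bracket F u g f)"
  unfolding bracket_def supp_adjoint by (simp add: adjoint_form_def)

lemma bivariate_functional_adjoint:
  "bivariate_functional F u \<Longrightarrow> bivariate_functional F (adjoint_form u)"
  unfolding bivariate_functional_def supp_adjoint sesquilinear_def
  by (auto simp: adjoint_form_def)

lemma gram_adjoint: "gram F (adjoint_form u) = sm_adjoint (gram F u)"
  by (simp add: gram_def sm_adjoint_def bracket_adjoint)

text \<open>Taking adjoints reverses the factorization and conjugates the diagonal. The comparison
  is made on entries, since the adjoint factor has infinite rows.\<close>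

lemma gauss_borel_adjoint:
  assumes "gauss_borel G S1 H S2"
  shows "gauss_borel (sm_adjoint G) S2 (\<lambda>k. cnj (H k)) S1"
proof -
  let ?A = "sm_inv S1" and ?B = "sm_inv S2"
  have A: "banded 0 ?A" and B: "banded 0 ?B"
    using assms by (auto simp: gauss_borel_def intro: lower_unitriangular_banded sm_inv(1))
  \<comment> \<open>The range up to i + j covers row i and does not change when i and j are
    exchanged.\<close>
  have entry: "sm_mult (sm_mult A (sm_diag D)) (sm_adjoint B) i j =
      (\<Sum>k\<le>i + j. A i k * D k * cnj (B j k))" if "banded 0 A" "banded 0 B" for A B D i j
  proof -
    have AD: "sm_mult A (sm_diag D) i k = A i k * D k" for k
    proof -
      have "sm_mult A (sm_diag D) i k = (\<Sum>p\<le>i + k. A i p * sm_diag D p k)"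
        by (rule sm_mult_eq_sum[OF that(1)]) simp
      also have "\<dots> = (\<Sum>p\<le>i + k. if p = k then A i p * D k else 0)"
        by (rule sum.cong) (auto simp: sm_diag_def)
      finally show ?thesis by simp
    qed
    show ?thesis
      using banded_sm_mult[OF that(1) banded_sm_diag, of D]
      by (subst sm_mult_eq_sum[where n = "i + j"]) (auto simp: AD sm_adjoint_def)
  qed
  have "G i j = (\<Sum>k\<le>i + j. ?A i k * H k * cnj (?B j k))" for i j
    using assms entry[OF A B] by (simp add: gauss_borel_def)
  then have "sm_adjoint G i j = (\<Sum>k\<le>i + j. ?B i k * cnj (H k) * cnj (?A j k))" for i j
    by (simp add: sm_adjoint_def add.commute mult_ac)
  then have "sm_adjoint G = sm_mult (sm_mult ?B (sm_diag (\<lambda>k. cnj (H k)))) (sm_adjoint ?A)"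
    by (intro ext) (simp only: entry[OF B A])
  then show ?thesis using assms by (simp add: gauss_borel_def)
qed

text \<open>Exchanging the arguments moves division and point derivatives from the second variable
  to the first, and the conjugations cancel.\<close>

lemma gu_form21_eq_adjoint:
  "gu_form21 F u L M d \<zeta> m \<xi> = adjoint_form (gu_form12 F (adjoint_form u) L M d \<zeta> m \<xi>)"
  unfolding gu_form21_def gu_form12_def bracket_adjoint
  by (simp add: adjoint_form_def mult_ac)

lemma second_kind_adjoint:
  "second_kind1 F (adjoint_form u) = second_kind2 F u"
  "second_kind2 F (adjoint_form u) = second_kind1 F u"
  unfolding second_kind1_def second_kind2_def fun_eq_iff bracket_adjoint by simp_all

lemma cd_kernel_cnj: "cd_kernel (\<lambda>k. cnj (H k)) P Q l x y = cnj (cd_kernel H Q P l y x)"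
  by (simp add: cd_kernel_def mult_ac)

lemma adjoint_adjoint [simp]: "adjoint_form (adjoint_form u) = u"
  by (simp add: adjoint_form_def)

lemma diff_quot_leval_cnj:
  assumes "x \<noteq> 0"
  shows "cnj (diff_quot (leval L) (cnj x) y) = diff_quot (lbar L) (cnj y) x"
proof (cases "cnj x = y")
  case True
  \<comment> \<open>On the diagonal both sides are derivatives; conjugation before and after L
    conjugates the derivative, which exists because x is nonzero.\<close>
  have "(leval L has_field_derivative deriv (leval L) (cnj x)) (at (cnj x))"
    by (rule holomorphic_derivI[OF holomorphic_on_leval]) (use assms in auto)
  then have "((cnj \<circ> leval L \<circ> cnj) has_field_derivative cnj (deriv (leval L) (cnj x))) (at x)"
    by (rule has_field_derivative_cnj_cnj)
  then have "deriv (lbar L) x = cnj (deriv (leval L) (cnj x))"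
    by (intro DERIV_imp_deriv) (simp add: lbar_def[abs_def] o_def)
  then show ?thesis using True by (auto simp: diff_quot_def)
next
  case False
  then have "cnj y \<noteq> x" by auto
  with False show ?thesis
    by (simp add: diff_quot_def lbar_def divide_simps) (simp add: algebra_simps)
qed

text \<open>The second block matrix is the first one built from the conjugated connector, so
  conjugating all three factors passes from one to the other.\<close>

lemma window_product_cnj:
  "cnj (window_product N\<Gamma> NC l a (conn_block12 \<Omega> N\<Gamma> NC l) b) =
    window_product N\<Gamma> NC l (\<lambda>k. cnj (a k)) (conn_block21 \<Omega> N\<Gamma> NC l) (\<lambda>k. cnj (b k))"
proof -
  have "conn_block21 \<Omega> N\<Gamma> NC l = conn_block12 (\<lambda>i j. cnj (\<Omega> i j)) N\<Gamma> NC l"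
    unfolding conn_block21_def conn_block12_def
    by (intro arg_cong2[where f = "\<lambda>x y. four_block_mat _ x y _"] arg_cong[where f = uminus] eq_matI)
       (auto simp: conn_C_def conn_Gamma_def)
  then show ?thesis by (simp add: window_product_conn_block12)
qed


section \<open>Specialization to the two Geronimus-Uvarov perturbations\<close>

theorem proposition13:
  fixes F :: "(complex \<Rightarrow> complex) set"
    and u u12 u21 :: form
    and L\<Gamma>1 L\<Gamma>2 LC1 LC2 :: laurent
    and Np\<Gamma> Nm\<Gamma> NpC NmC N\<Gamma> NC d1 d2 l :: nat
    and \<zeta>1 \<zeta>2 :: "nat \<Rightarrow> complex"
    and m1 m2 :: "nat \<Rightarrow> nat"
    and \<xi>1 \<xi>2 :: "nat \<Rightarrow> nat \<Rightarrow> (complex \<Rightarrow> complex) \<Rightarrow> complex"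
    and S1 S2 S12_1 S12_2 S21_1 S21_2 \<Omega>12_2 \<Omega>21_1 :: smat
    and H H12 H21 :: "nat \<Rightarrow> complex"
    and \<phi>1 \<phi>2 \<phi>12_1 \<phi>12_2 \<phi>21_1 \<phi>21_2 C1 C2 C12_1 C12_2 C21_1 C21_2 :: "nat \<Rightarrow> complex \<Rightarrow> complex"
    and x1 x2 :: complex
  assumes F: "fundamental_space F"
    and u: "bivariate_functional F u"
    and G: "quasidefinite (gram F u)" "gauss_borel (gram F u) S1 H S2"
    and deg\<Gamma>: "laurent_degrees L\<Gamma>1 Np\<Gamma> Nm\<Gamma>" "laurent_degrees L\<Gamma>2 Np\<Gamma> Nm\<Gamma>"
    and degC: "laurent_degrees LC1 NpC NmC" "laurent_degrees LC2 NpC NmC"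
    and N: "N\<Gamma> = max Np\<Gamma> Nm\<Gamma>" "NC = max NpC NmC"
    and disjoint: "lzeros L\<Gamma>1 \<inter> supp1 F u = {}" "lzeros L\<Gamma>2 \<inter> supp2 F u = {}"
    and zeros: "zeros_enum L\<Gamma>1 d1 \<zeta>1 m1" "zeros_enum L\<Gamma>2 d2 \<zeta>2 m2"
    and \<xi>: "\<And>i k. i \<in> {1..d1} \<Longrightarrow> k < m1 i \<Longrightarrow> linear_functional F (\<xi>1 i k)"
           "\<And>i k. i \<in> {1..d2} \<Longrightarrow> k < m2 i \<Longrightarrow> linear_functional F (\<xi>2 i k)"
    and u12_def: "u12 = gu_form12 F u L\<Gamma>1 LC2 d1 \<zeta>1 m1 \<xi>1"
    and u21_def: "u21 = gu_form21 F u L\<Gamma>2 LC1 d2 \<zeta>2 m2 \<xi>2"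
    and u12: "bivariate_functional F u12"
    and u21: "bivariate_functional F u21"
    and G12: "quasidefinite (gram F u12)" "gauss_borel (gram F u12) S12_1 H12 S12_2"
    and G21: "quasidefinite (gram F u21)" "gauss_borel (gram F u21) S21_1 H21 S21_2"
    and \<phi>: "\<phi>1 = cmv_poly S1" "\<phi>2 = cmv_poly S2"
    and \<phi>12: "\<phi>12_1 = cmv_poly S12_1" "\<phi>12_2 = cmv_poly S12_2"
    and \<phi>21: "\<phi>21_1 = cmv_poly S21_1" "\<phi>21_2 = cmv_poly S21_2"
    and C: "C1 = second_kind1 F u \<phi>1" "C2 = second_kind2 F u \<phi>2"
    and C12: "C12_1 = second_kind1 F u12 \<phi>12_1" "C12_2 = second_kind2 F u12 \<phi>12_2"
    and C21: "C21_1 = second_kind1 F u21 \<phi>21_1" "C21_2 = second_kind2 F u21 \<phi>21_2"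
    and \<Omega>: "\<Omega>12_2 = connector S12_2 LC2 S2" "\<Omega>21_1 = connector S21_1 LC1 S1"
    and l: "l \<ge> 2 * max NC N\<Gamma>"
    and x: "x1 \<noteq> 0" "x2 \<noteq> 0"
  shows
    "(cnj x1 \<notin> supp1 F u \<union> supp1 F u12 \<longrightarrow>
        leval L\<Gamma>1 (cnj x1) * cd_kernel H12 C12_2 \<phi>12_1 l x1 x2
          - leval L\<Gamma>1 x2 * cd_kernel H C2 \<phi>1 l x1 x2
          - diff_quot (leval L\<Gamma>1) (cnj x1) x2
        = window_product N\<Gamma> NC l (\<lambda>k. \<phi>12_1 k x2 / H12 k)
            (conn_block12 \<Omega>12_2 N\<Gamma> NC l) (\<lambda>k. cnj (C2 k x1)))
     \<and>
     (cnj x1 \<notin> supp1 F u \<union> supp1 F u21 \<longrightarrow>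
        leval LC1 x2 * cd_kernel H21 C21_2 \<phi>21_1 l x1 x2
          - bracket F u (\<lambda>z1. leval LC1 z1 / (cnj x1 - z1))
                        (\<lambda>z2. cnj (cd_kernel H \<phi>2 \<phi>1 l z2 x2))
        = window_product N\<Gamma> NC l (\<lambda>k. cnj (C21_2 k x1) / H21 k)
            (conn_block21 \<Omega>21_1 N\<Gamma> NC l) (\<lambda>k. \<phi>1 k x2))
     \<and>
     (cnj x2 \<notin> supp2 F u \<union> supp2 F u12 \<longrightarrow>
        cnj (leval LC2 x1) * cd_kernel H12 \<phi>12_2 C12_1 l x1 x2
          - bracket F u (\<lambda>z1. cd_kernel H \<phi>2 \<phi>1 l x1 z1)
                        (\<lambda>z2. leval LC2 z2 / (cnj x2 - z2))
        = window_product N\<Gamma> NC l (\<lambda>k. C12_1 k x2 / H12 k)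
            (conn_block12 \<Omega>12_2 N\<Gamma> NC l) (\<lambda>k. cnj (\<phi>2 k x1)))
     \<and>
     (cnj x2 \<notin> supp2 F u \<union> supp2 F u21 \<longrightarrow>
        lbar L\<Gamma>2 x2 * cd_kernel H21 \<phi>21_2 C21_1 l x1 x2
          - lbar L\<Gamma>2 (cnj x1) * cd_kernel H \<phi>2 C1 l x1 x2
          - diff_quot (lbar L\<Gamma>2) (cnj x1) x2
        = window_product N\<Gamma> NC l (\<lambda>k. cnj (\<phi>21_2 k x1) / H21 k)
            (conn_block21 \<Omega>21_1 N\<Gamma> NC l) (\<lambda>k. C1 k x2))"
proof -
  have lN: "2 * NC \<le> l" "2 * N\<Gamma> \<le> l" using l by auto
  interpret W: intertwined_forms F u S1 S2 H u12 S12_1 S12_2 H12 L\<Gamma>1 LC2 N\<Gamma> NC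
    unfolding u12_def
  proof (rule intertwined_forms_gu_form12)
    show "bivariate_functional F (gu_form12 F u L\<Gamma>1 LC2 d1 \<zeta>1 m1 \<xi>1)"
      "gauss_borel (gram F (gu_form12 F u L\<Gamma>1 LC2 d1 \<zeta>1 m1 \<xi>1)) S12_1 H12 S12_2"
      using u12 G12(2) by (simp_all add: u12_def)
  qed (use F u G(2) disjoint(1) zeros(1) in \<open>simp_all add: laurent_degrees_bound[OF deg\<Gamma>(1)]
      laurent_degrees_bound[OF degC(2)] N\<close>)
  \<comment> \<open>The adjoint of \<open>u21\<close> perturbs the adjoint of \<open>u\<close>, now
    with \<open>L\<Gamma>2\<close> acting on the first variable. The roles of the triangular factors
    are exchanged, so the connector of this pair is \<open>\<Omega>21_1\<close>.\<close>
  define v where "v = gu_form12 F (adjoint_form u) L\<Gamma>2 LC1 d2 \<zeta>2 m2 \<xi>2"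
  have v: "v = adjoint_form u21"
    by (simp add: u21_def gu_form21_eq_adjoint v_def)
  interpret A: intertwined_forms F "adjoint_form u" S2 S1 "\<lambda>k. cnj (H k)"
    v S21_2 S21_1 "\<lambda>k. cnj (H21 k)" L\<Gamma>2 LC1 N\<Gamma> NC
    unfolding v_def
  proof (rule intertwined_forms_gu_form12)
    show "bivariate_functional F (gu_form12 F (adjoint_form u) L\<Gamma>2 LC1 d2 \<zeta>2 m2 \<xi>2)"
      "gauss_borel (gram F (gu_form12 F (adjoint_form u) L\<Gamma>2 LC1 d2 \<zeta>2 m2 \<xi>2))
        S21_2 (\<lambda>k. cnj (H21 k)) S21_1"
      using bivariate_functional_adjoint[OF u21] gauss_borel_adjoint[OF G21(2)]
      by (simp_all add: v_def[symmetric] v gram_adjoint)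
    show "gauss_borel (gram F (adjoint_form u)) S2 (\<lambda>k. cnj (H k)) S1"
      using gauss_borel_adjoint[OF G(2)] by (simp add: gram_adjoint)
  qed (use F disjoint(2) zeros(2) in \<open>simp_all add: laurent_degrees_bound[OF deg\<Gamma>(2)]
      laurent_degrees_bound[OF degC(1)] N supp_adjoint bivariate_functional_adjoint[OF u]\<close>)
  note defs = \<phi> \<phi>12 \<phi>21 C C12 C21 \<Omega>
  note adj = v supp_adjoint second_kind_adjoint cd_kernel_cnj bracket_adjoint
  show ?thesis
  proof (intro conjI impI)
    assume "cnj x1 \<notin> supp1 F u \<union> supp1 F u12"
    then show "leval L\<Gamma>1 (cnj x1) * cd_kernel H12 C12_2 \<phi>12_1 l x1 x2
          - leval L\<Gamma>1 x2 * cd_kernel H C2 \<phi>1 l x1 x2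
          - diff_quot (leval L\<Gamma>1) (cnj x1) x2
        = window_product N\<Gamma> NC l (\<lambda>k. \<phi>12_1 k x2 / H12 k)
            (conn_block12 \<Omega>12_2 N\<Gamma> NC l) (\<lambda>k. cnj (C2 k x1))"
      unfolding defs by (rule W.mixed_kernel_second_kind2[OF lN x])
  next
    assume "cnj x1 \<notin> supp1 F u \<union> supp1 F u21"
    then have "cnj x1 \<notin> supp2 F (adjoint_form u) \<union> supp2 F v"
      by (simp add: adj)
    \<comment> \<open>Formula (iii) for the adjoint pair, with \<open>x1\<close> and
      \<open>x2\<close> exchanged, is conjugated to give (ii).\<close>
    from arg_cong[OF A.mixed_kernel_second_kind1[OF lN x(2,1) this], of cnj]
    show "leval LC1 x2 * cd_kernel H21 C21_2 \<phi>21_1 l x1 x2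
          - bracket F u (\<lambda>z1. leval LC1 z1 / (cnj x1 - z1))
                        (\<lambda>z2. cnj (cd_kernel H \<phi>2 \<phi>1 l z2 x2))
        = window_product N\<Gamma> NC l (\<lambda>k. cnj (C21_2 k x1) / H21 k)
            (conn_block21 \<Omega>21_1 N\<Gamma> NC l) (\<lambda>k. \<phi>1 k x2)"
      unfolding defs by (simp add: adj window_product_cnj)
  next
    assume "cnj x2 \<notin> supp2 F u \<union> supp2 F u12"
    then show "cnj (leval LC2 x1) * cd_kernel H12 \<phi>12_2 C12_1 l x1 x2
          - bracket F u (\<lambda>z1. cd_kernel H \<phi>2 \<phi>1 l x1 z1)
                        (\<lambda>z2. leval LC2 z2 / (cnj x2 - z2))
        = window_product N\<Gamma> NC l (\<lambda>k. C12_1 k x2 / H12 k)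
            (conn_block12 \<Omega>12_2 N\<Gamma> NC l) (\<lambda>k. cnj (\<phi>2 k x1))"
      unfolding defs by (rule W.mixed_kernel_second_kind1[OF lN x])
  next
    assume "cnj x2 \<notin> supp2 F u \<union> supp2 F u21"
    then have "cnj x2 \<notin> supp1 F (adjoint_form u) \<union> supp1 F v"
      by (simp add: adj)
    \<comment> \<open>Formula (i) for the adjoint pair, with \<open>x1\<close> and \<open>x2\<close>
      exchanged, is conjugated to give (iv); this turns \<open>leval\<close> into
      \<open>lbar\<close>.\<close>
    from arg_cong[OF A.mixed_kernel_second_kind2[OF lN x(2,1) this], of cnj]
    show "lbar L\<Gamma>2 x2 * cd_kernel H21 \<phi>21_2 C21_1 l x1 x2
          - lbar L\<Gamma>2 (cnj x1) * cd_kernel H \<phi>2 C1 l x1 x2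
          - diff_quot (lbar L\<Gamma>2) (cnj x1) x2
        = window_product N\<Gamma> NC l (\<lambda>k. cnj (\<phi>21_2 k x1) / H21 k)
            (conn_block21 \<Omega>21_1 N\<Gamma> NC l) (\<lambda>k. C1 k x2)"
      unfolding defs
      by (simp add: adj window_product_cnj diff_quot_leval_cnj[OF x(2)] lbar_def[symmetric])
         (simp add: lbar_def)
  qed
qed

end
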